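(* Let $k\ge 2$ and let $m_1,\dots,m_k$ be integers with each $m_i>1$. Let $X=\mathbf{H}^{m_1}\times\cdots\times\mathbf{H}^{m_k}$ with the product metric, where $\mathbf{H}^m$ denotes $m$-dimensional real hyperbolic space, and let $N=(m_1+\cdots+m_k)-k+1$. Then there is a quasi-isometric embedding of $\mathbf{H}^{N}$ in $X$ whose image is not quasiconvex in $X$, and there is an $N$-dimensional solvable Lie group (with a left-invariant Riemannian metric) admitting a quasi-isometric embedding in $X$ whose image is not quasiconvex in $X$.
   Context: A map $f:(Y,d_Y)\to(X,d_X)$ between metric spaces (not necessarily continuous) is a quasi-isometric embedding if there are constants $K\ge1$, $\epsilon\ge0$ with $\frac1K d_Y(y_1,y_2)-\epsilon\le d_X(f(y_1),f(y_2))\le K d_Y(y_1,y_2)+\epsilon$ for all $y_1,y_2\in Y$. A subset $Y$ of a metric space $X$ is quasiconvex in $X$ if there is a constant $D\ge0$ such that any geodesic in $X$ between points $y_1,y_2\in Y$ lies in the $D$-neighborhood of $Y$. *)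

theory Defs
  imports "HOL-Analysis.Analysis" "HOL-Algebra.Solvable_Groups"
begin

section \<open>Coarse geometry\<close>

text \<open>A metric space is given by its carrier and its distance function.\<close>

definition quasi_isometric_embedding ::
  "'a set \<Rightarrow> ('a \<Rightarrow> 'a \<Rightarrow> real) \<Rightarrow> 'b set \<Rightarrow> ('b \<Rightarrow> 'b \<Rightarrow> real) \<Rightarrow> ('a \<Rightarrow> 'b) \<Rightarrow> bool" where
  "quasi_isometric_embedding Y dY X dX f \<longleftrightarrow>
     f \<in> Y \<rightarrow> X \<and>
     (\<exists>K \<epsilon>. K \<ge> 1 \<and> \<epsilon> \<ge> 0 \<and>
        (\<forall>y1\<in>Y. \<forall>y2\<in>Y. 1 / K * dY y1 y2 - \<epsilon> \<le> dX (f y1) (f y2) \<and>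
                        dX (f y1) (f y2) \<le> K * dY y1 y2 + \<epsilon>))"

definition geodesic_between ::
  "'a set \<Rightarrow> ('a \<Rightarrow> 'a \<Rightarrow> real) \<Rightarrow> 'a \<Rightarrow> 'a \<Rightarrow> real \<Rightarrow> (real \<Rightarrow> 'a) \<Rightarrow> bool" where
  "geodesic_between X d x y L c \<longleftrightarrow>
     L \<ge> 0 \<and> c \<in> {0..L} \<rightarrow> X \<and> c 0 = x \<and> c L = y \<and>
     (\<forall>s\<in>{0..L}. \<forall>t\<in>{0..L}. d (c s) (c t) = \<bar>s - t\<bar>)"

definition quasiconvex :: "'a set \<Rightarrow> ('a \<Rightarrow> 'a \<Rightarrow> real) \<Rightarrow> 'a set \<Rightarrow> bool" where
  "quasiconvex X d Y \<longleftrightarrow>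
     Y \<subseteq> X \<and>
     (\<exists>D\<ge>0. \<forall>y1\<in>Y. \<forall>y2\<in>Y. \<forall>L c. geodesic_between X d y1 y2 L c \<longrightarrow>
        (\<forall>t\<in>{0..L}. \<exists>y\<in>Y. d (c t) y \<le> D))"

section \<open>Hyperbolic spaces and their products\<close>

text \<open>The upper half-space model: points of \<open>\<real>\<^sup>n\<close> (\<open>n \<ge> 1\<close>, coordinates \<open>0, \<dots>, n - 1\<close>) whose
  last coordinate is positive, with the distance of constant curvature \<open>-1\<close>,
  \<open>cosh d(x,y) = 1 + |x - y|\<^sup>2 / (2 x\<^bsub>n-1\<^esub> y\<^bsub>n-1\<^esub>)\<close>.\<close>

definition hyp_space :: "nat \<Rightarrow> (nat \<Rightarrow> real) set" where
  "hyp_space n = {x \<in> topspace (Euclidean_space n). 0 < x (n - 1)}"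

definition hyp_dist :: "nat \<Rightarrow> (nat \<Rightarrow> real) \<Rightarrow> (nat \<Rightarrow> real) \<Rightarrow> real" where
  "hyp_dist n x y = arcosh (1 + (\<Sum>i<n. (x i - y i)\<^sup>2) / (2 * x (n - 1) * y (n - 1)))"

definition hyp_prod :: "nat \<Rightarrow> (nat \<Rightarrow> nat) \<Rightarrow> (nat \<Rightarrow> nat \<Rightarrow> real) set" where
  "hyp_prod k m = (\<Pi>\<^sub>E i\<in>{..<k}. hyp_space (m i))"

definition hyp_prod_dist ::
  "nat \<Rightarrow> (nat \<Rightarrow> nat) \<Rightarrow> (nat \<Rightarrow> nat \<Rightarrow> real) \<Rightarrow> (nat \<Rightarrow> nat \<Rightarrow> real) \<Rightarrow> real" where
  "hyp_prod_dist k m x y = L2_set (\<lambda>i. hyp_dist (m i) (x i) (y i)) {..<k}"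

section \<open>Smooth manifolds\<close>

text \<open>\<open>\<real>\<^sup>n\<close> is the space \<open>Euclidean_space n\<close> of sequences vanishing from index \<open>n\<close> on.\<close>

definition partial_deriv ::
  "nat \<Rightarrow> ((nat \<Rightarrow> real) \<Rightarrow> real) \<Rightarrow> (nat \<Rightarrow> real) \<Rightarrow> real" where
  "partial_deriv i f x = deriv (\<lambda>t. f (x(i := t))) (x i)"

text \<open>For \<open>U\<close> open in \<open>\<real>\<^sup>n\<close>: all iterated partial derivatives of \<open>f\<close> exist and are
  continuous on \<open>U\<close>.\<close>

definition smooth_fun :: "nat \<Rightarrow> (nat \<Rightarrow> real) set \<Rightarrow> ((nat \<Rightarrow> real) \<Rightarrow> real) \<Rightarrow> bool" where
  "smooth_fun n U f \<longleftrightarrow>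
     (\<forall>is. set is \<subseteq> {..<n} \<longrightarrow>
        continuous_map (subtopology (Euclidean_space n) U) euclideanreal (foldr partial_deriv is f) \<and>
        (\<forall>i<n. \<forall>x\<in>U. (\<lambda>t. foldr partial_deriv is f (x(i := t))) differentiable at (x i)))"

text \<open>A chart is a pair of its domain and its coordinate map.\<close>

type_synonym 'a chart = "'a set \<times> ('a \<Rightarrow> nat \<Rightarrow> real)"

definition chart_inv :: "'a chart \<Rightarrow> (nat \<Rightarrow> real) \<Rightarrow> 'a" where
  "chart_inv c = inv_into (fst c) (snd c)"

definition is_chart :: "nat \<Rightarrow> 'a topology \<Rightarrow> 'a chart \<Rightarrow> bool" where
  "is_chart n T c \<longleftrightarrow>
     openin T (fst c) \<and> openin (Euclidean_space n) (snd c ` fst c) \<and>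
     homeomorphic_map (subtopology T (fst c)) (subtopology (Euclidean_space n) (snd c ` fst c)) (snd c)"

definition smooth_manifold :: "nat \<Rightarrow> 'a topology \<Rightarrow> 'a chart set \<Rightarrow> bool" where
  "smooth_manifold n T A \<longleftrightarrow>
     Hausdorff_space T \<and> second_countable T \<and>
     (\<forall>c\<in>A. is_chart n T c) \<and> (\<Union>c\<in>A. fst c) = topspace T \<and>
     (\<forall>c\<in>A. \<forall>c'\<in>A. \<forall>j<n.
        smooth_fun n (snd c ` (fst c \<inter> fst c')) (\<lambda>x. snd c' (chart_inv c x) j))"

definition smooth_map ::
  "nat \<Rightarrow> 'a topology \<Rightarrow> 'a chart set \<Rightarrow> nat \<Rightarrow> 'b topology \<Rightarrow> 'b chart set \<Rightarrow> ('a \<Rightarrow> 'b) \<Rightarrow> bool" where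
  "smooth_map n T A n' T' A' f \<longleftrightarrow>
     continuous_map T T' f \<and>
     (\<forall>c\<in>A. \<forall>c'\<in>A'. \<forall>j<n'.
        smooth_fun n (snd c ` (fst c \<inter> f -` fst c')) (\<lambda>x. snd c' (f (chart_inv c x)) j))"

text \<open>Product charts: the coordinates of the second factor are appended after the \<open>n\<close>
  coordinates of the first.\<close>

definition prod_chart :: "nat \<Rightarrow> 'a chart \<Rightarrow> 'b chart \<Rightarrow> ('a \<times> 'b) chart" where
  "prod_chart n c c' =
     (fst c \<times> fst c', \<lambda>(p, q) i. if i < n then snd c p i else snd c' q (i - n))"

definition prod_atlas :: "nat \<Rightarrow> 'a chart set \<Rightarrow> 'b chart set \<Rightarrow> ('a \<times> 'b) chart set" where
  "prod_atlas n A A' = {prod_chart n c c' | c c'. c \<in> A \<and> c' \<in> A'}"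

section \<open>Lie groups and Riemannian metrics\<close>

definition lie_group ::
  "nat \<Rightarrow> ('a, 'b) monoid_scheme \<Rightarrow> 'a topology \<Rightarrow> 'a chart set \<Rightarrow> bool" where
  "lie_group n G T A \<longleftrightarrow>
     group G \<and> topspace T = carrier G \<and> smooth_manifold n T A \<and>
     smooth_map (n + n) (prod_topology T T) (prod_atlas n A A) n T A (\<lambda>(x, y). x \<otimes>\<^bsub>G\<^esub> y) \<and>
     smooth_map n T A n T A (\<lambda>x. inv\<^bsub>G\<^esub> x)"

text \<open>\<open>jacobian c c' f p a i\<close> is the entry \<open>\<partial>f\<^sub>a/\<partial>x\<^sub>i\<close> at \<open>p\<close> of the Jacobian matrix of \<open>f\<close>, read
  in \<open>c\<close> on the source and in \<open>c'\<close> on the target.\<close>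

definition jacobian ::
  "'a chart \<Rightarrow> 'b chart \<Rightarrow> ('a \<Rightarrow> 'b) \<Rightarrow> 'a \<Rightarrow> nat \<Rightarrow> nat \<Rightarrow> real" where
  "jacobian c c' f p a i = partial_deriv i (\<lambda>x. snd c' (f (chart_inv c x)) a) (snd c p)"

text \<open>A tensor of type \<open>(0,2)\<close> is given by its components: \<open>g c p i j\<close> is the value at the point \<open>p\<close>
  on the \<open>i\<close>-th and \<open>j\<close>-th coordinate vectors of the chart \<open>c\<close>. The following predicate says that
  \<open>f\<^sup>*g = g\<close>. For \<open>f\<close> the identity it is the transformation law under a change of charts.\<close>

definition preserves_metric ::
  "nat \<Rightarrow> 'a chart set \<Rightarrow> ('a chart \<Rightarrow> 'a \<Rightarrow> nat \<Rightarrow> nat \<Rightarrow> real) \<Rightarrow> ('a \<Rightarrow> 'a) \<Rightarrow> bool" where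
  "preserves_metric n A g f \<longleftrightarrow>
     (\<forall>c\<in>A. \<forall>c'\<in>A. \<forall>p\<in>fst c. f p \<in> fst c' \<longrightarrow>
        (\<forall>i<n. \<forall>j<n. g c p i j =
           (\<Sum>a<n. \<Sum>b<n. g c' (f p) a b * jacobian c c' f p a i * jacobian c c' f p b j)))"

definition riemannian_metric ::
  "nat \<Rightarrow> 'a chart set \<Rightarrow> ('a chart \<Rightarrow> 'a \<Rightarrow> nat \<Rightarrow> nat \<Rightarrow> real) \<Rightarrow> bool" where
  "riemannian_metric n A g \<longleftrightarrow>
     (\<forall>c\<in>A.
        (\<forall>p\<in>fst c. \<forall>i<n. \<forall>j<n. g c p i j = g c p j i) \<and>
        (\<forall>p\<in>fst c. \<forall>v. (\<exists>i<n. v i \<noteq> 0) \<longrightarrow> 0 < (\<Sum>i<n. \<Sum>j<n. g c p i j * v i * v j)) \<and>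
        (\<forall>i<n. \<forall>j<n. smooth_fun n (snd c ` fst c) (\<lambda>x. g c (chart_inv c x) i j))) \<and>
     preserves_metric n A g (\<lambda>p. p)"

definition left_invariant ::
  "nat \<Rightarrow> ('a, 'b) monoid_scheme \<Rightarrow> 'a chart set \<Rightarrow> ('a chart \<Rightarrow> 'a \<Rightarrow> nat \<Rightarrow> nat \<Rightarrow> real) \<Rightarrow> bool" where
  "left_invariant n G A g \<longleftrightarrow> (\<forall>a\<in>carrier G. preserves_metric n A g (\<lambda>x. a \<otimes>\<^bsub>G\<^esub> x))"

definition C1_on :: "real \<Rightarrow> real \<Rightarrow> (real \<Rightarrow> real) \<Rightarrow> bool" where
  "C1_on s t h \<longleftrightarrow>
     (\<exists>h'. continuous_on {s..t} h' \<and>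
        (\<forall>u\<in>{s..t}. (h has_real_derivative h' u) (at u within {s..t})))"

text \<open>\<open>F\<close> is the set of break points.\<close>

definition piecewise_C1_curve ::
  "nat \<Rightarrow> 'a topology \<Rightarrow> 'a chart set \<Rightarrow> (real \<Rightarrow> 'a) \<Rightarrow> bool" where
  "piecewise_C1_curve n T A \<gamma> \<longleftrightarrow>
     pathin T \<gamma> \<and>
     (\<exists>F. finite F \<and>
        (\<forall>c\<in>A. \<forall>s t. 0 \<le> s \<and> s < t \<and> t \<le> 1 \<and> {s<..<t} \<inter> F = {} \<and> \<gamma> ` {s..t} \<subseteq> fst c \<longrightarrow>
           (\<forall>i<n. C1_on s t (\<lambda>u. snd c (\<gamma> u) i))))"

text \<open>The speed at \<open>t\<close> may be computed in any chart around \<open>\<gamma> t\<close>; its values at the end points and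
  at the finitely many break points are irrelevant for the length.\<close>

definition speed ::
  "nat \<Rightarrow> 'a chart set \<Rightarrow> ('a chart \<Rightarrow> 'a \<Rightarrow> nat \<Rightarrow> nat \<Rightarrow> real) \<Rightarrow> (real \<Rightarrow> 'a) \<Rightarrow> real \<Rightarrow> real" where
  "speed n A g \<gamma> t =
     (let c = (SOME c. c \<in> A \<and> \<gamma> t \<in> fst c);
          v = (\<lambda>i. deriv (\<lambda>u. snd c (\<gamma> u) i) t)
      in sqrt (\<Sum>i<n. \<Sum>j<n. g c (\<gamma> t) i j * v i * v j))"

definition curve_length ::
  "nat \<Rightarrow> 'a chart set \<Rightarrow> ('a chart \<Rightarrow> 'a \<Rightarrow> nat \<Rightarrow> nat \<Rightarrow> real) \<Rightarrow> (real \<Rightarrow> 'a) \<Rightarrow> real" where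
  "curve_length n A g \<gamma> = integral {0..1} (speed n A g \<gamma>)"

text \<open>This is the Riemannian distance only if \<open>T\<close> is connected, as otherwise the infimum may be
  over the empty set.\<close>

definition riemannian_dist ::
  "nat \<Rightarrow> 'a topology \<Rightarrow> 'a chart set \<Rightarrow> ('a chart \<Rightarrow> 'a \<Rightarrow> nat \<Rightarrow> nat \<Rightarrow> real) \<Rightarrow> 'a \<Rightarrow> 'a \<Rightarrow> real" where
  "riemannian_dist n T A g p q =
     Inf {curve_length n A g \<gamma> | \<gamma>. piecewise_C1_curve n T A \<gamma> \<and> \<gamma> 0 = p \<and> \<gamma> 1 = q}"

end

theory Submission
  imports Defs
begin

text \<open>In the upper half-space model write a point of \<open>H\<^sup>N\<close> as \<open>(x\<^sub>1, \<dots>, x\<^sub>k, h)\<close> with horizontal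
  blocks \<open>x\<^sub>i\<close> of \<open>m i - 1\<close> coordinates and height \<open>h\<close>, and send it to the tuple of the points
  \<open>(x\<^sub>i, h)\<close>. No factor distance exceeds the distance \<open>d\<close> in \<open>H\<^sup>N\<close>, and \<open>cosh d - 1\<close> is at
  most the sum of the corresponding terms of the factors, so this is a quasi-isometric embedding.
  Its image consists of the points whose factors have equal heights, while a geodesic that moves in
  one factor only can leave every given neighbourhood of this set.

  For the second claim, \<open>H\<^sup>N\<close> itself is a solvable Lie group with the left-invariant metric
  \<open>dt\<^sup>2 + e\<^bsup>-2t\<^esup> dx\<^sup>2\<close>, where \<open>t = ln h\<close>. A coarse comparison of its Riemannian distance with
  \<open>hyp_dist\<close> suffices: a curve of length \<open>L\<close> starting at \<open>t\<^sub>0\<close> changes \<open>t\<close> by at most \<open>L\<close>, hence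
  each horizontal coordinate by at most \<open>L exp (t\<^sub>0 + L)\<close>; conversely two points are joined by a
  curve that goes up, across and down.\<close>

section \<open>The equal-height embedding\<close>

lemma quasi_isometric_embedding_compose:
  assumes "quasi_isometric_embedding Y dY Z dZ f" "quasi_isometric_embedding Z dZ X dX g"
  shows "quasi_isometric_embedding Y dY X dX (g \<circ> f)"
proof -
  obtain K a where f: "f \<in> Y \<rightarrow> Z" and K: "K \<ge> 1" "a \<ge> 0"
    and fd: "\<And>x y. x \<in> Y \<Longrightarrow> y \<in> Y \<Longrightarrow> 1 / K * dY x y - a \<le> dZ (f x) (f y) \<and> dZ (f x) (f y) \<le> K * dY x y + a"
    using assms(1) unfolding quasi_isometric_embedding_def by blast
  obtain L b where g: "g \<in> Z \<rightarrow> X" and L: "L \<ge> 1" "b \<ge> 0"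
    and gd: "\<And>x y. x \<in> Z \<Longrightarrow> y \<in> Z \<Longrightarrow> 1 / L * dZ x y - b \<le> dX (g x) (g y) \<and> dX (g x) (g y) \<le> L * dZ x y + b"
    using assms(2) unfolding quasi_isometric_embedding_def by blast
  \<comment> \<open>One additive constant serves both bounds: the lower one loses only
    \<open>a / L + b\<close>, which is at most \<open>L * a + b\<close> because \<open>L\<close> is
    at least 1.\<close>
  have "1 / (L * K) * dY x y - (L * a + b) \<le> dX (g (f x)) (g (f y)) \<and>
        dX (g (f x)) (g (f y)) \<le> (L * K) * dY x y + (L * a + b)" if "x \<in> Y" "y \<in> Y" for x y
  proof -
    have "f x \<in> Z" "f y \<in> Z"
      using f that by auto
    note gd' = gd[OF this] and fd' = fd[OF that]
    have "1 / L * (1 / K * dY x y - a) \<le> 1 / L * dZ (f x) (f y)"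
      by (intro mult_left_mono) (use fd' L in auto)
    moreover have "1 / L * a \<le> L * a"
      by (intro mult_right_mono) (use K L in \<open>auto simp: field_simps mult_ge1_I\<close>)
    moreover have "L * dZ (f x) (f y) \<le> L * (K * dY x y + a)"
      by (intro mult_left_mono) (use fd' L in auto)
    ultimately show ?thesis
      using gd' by (simp add: algebra_simps)
  qed
  moreover have "L * K \<ge> 1" "L * a + b \<ge> 0"
    using K L by (auto simp: mult_ge1_I)
  moreover have "g \<circ> f \<in> Y \<rightarrow> X"
    using f g by auto
  ultimately show ?thesis
    unfolding quasi_isometric_embedding_def o_def by blast
qed

text \<open>Since \<open>exp d\<close> is at most \<open>2 * cosh d\<close>, a constant factor in
  front of cosh costs only an additive constant in the distance. All coarse upper bounds on
  \<open>hyp_dist\<close> are obtained in this way.\<close>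

lemma le_cosh_exp_bound:
  fixes d e c :: real
  assumes "cosh d \<le> c * exp e" "c > 0"
  shows "d \<le> e + ln (2 * c)"
proof -
  have "exp d \<le> 2 * cosh d"
    by (simp add: cosh_field_def)
  also have "\<dots> \<le> exp (e + ln (2 * c))"
    using assms by (simp add: exp_add algebra_simps)
  finally show ?thesis
    by simp
qed

lemma cosh_le_exp_real: "(x::real) \<ge> 0 \<Longrightarrow> cosh x \<le> exp x"
  by (simp add: cosh_field_def)

section \<open>The distance of the upper half-space\<close>

context
  fixes n :: nat and x y :: "nat \<Rightarrow> real"
  assumes x: "x \<in> hyp_space n" and y: "y \<in> hyp_space n"
begin

lemma hyp_dist_arg_ge1: "1 + (\<Sum>i<n. (x i - y i)\<^sup>2) / (2 * x (n - 1) * y (n - 1)) \<ge> 1"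
  using x y by (auto simp: hyp_space_def intro!: divide_nonneg_nonneg sum_nonneg)

lemma cosh_hyp_dist:
  "cosh (hyp_dist n x y) = 1 + (\<Sum>i<n. (x i - y i)\<^sup>2) / (2 * x (n - 1) * y (n - 1))"
  unfolding hyp_dist_def by (rule cosh_arcosh_real[OF hyp_dist_arg_ge1])

lemma hyp_dist_nonneg: "hyp_dist n x y \<ge> 0"
  unfolding hyp_dist_def by (rule arcosh_nonneg_real[OF hyp_dist_arg_ge1])

text \<open>Dropping the horizontal terms leaves the formula for two points on a vertical line,
  whose distance is the difference of the logarithms of the heights. It will bound from below the
  distance to the set of points with equal heights.\<close>

lemma hyp_dist_ge_ln_height:
  assumes "n > 0"
  shows "hyp_dist n x y \<ge> \<bar>ln (x (n - 1)) - ln (y (n - 1))\<bar>"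
proof -
  define a b where "a = x (n - 1)" and "b = y (n - 1)"
  have ab: "a > 0" "b > 0"
    using x y by (auto simp: hyp_space_def a_def b_def)
  have "cosh \<bar>ln a - ln b\<bar> = cosh (ln (a / b))"
    using ab by (simp add: ln_div)
  also have "\<dots> = 1 + (a - b)\<^sup>2 / (2 * a * b)"
    using ab by (simp add: cosh_ln_real) (simp add: field_simps power2_eq_square)
  also have "\<dots> \<le> cosh (hyp_dist n x y)"
  proof -
    have "(a - b)\<^sup>2 \<le> (\<Sum>i<n. (x i - y i)\<^sup>2)"
      unfolding a_def b_def using assms by (intro member_le_sum) auto
    then show ?thesis
      using ab unfolding cosh_hyp_dist a_def[symmetric] b_def[symmetric]
        by (auto intro!: divide_right_mono)
  qed
  finally show ?thesis
    using cosh_real_nonneg_le_iff[of "\<bar>ln a - ln b\<bar>" "hyp_dist n x y"] hyp_dist_nonneg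
    by (simp add: a_def b_def)
qed

end

section \<open>Explicit geodesics of hyperbolic space\<close>

lemma hyp_dist_self: "hyp_dist n x x = 0"
  by (simp add: hyp_dist_def)

text \<open>The Euclidean half circle of radius \<open>r\<close> about the origin in the plane of
  coordinates \<open>0\<close> and \<open>n - 1\<close>, parametrized by hyperbolic arc length; the
  parameter 0 gives its apex, at height \<open>r\<close>.\<close>

definition semicircle :: "nat \<Rightarrow> real \<Rightarrow> real \<Rightarrow> nat \<Rightarrow> real" where
  "semicircle n r s = (\<lambda>j. 0)(0 := r * tanh s, n - 1 := r / cosh s)"

lemma semicircle_in_hyp_space: "n > 1 \<Longrightarrow> r > 0 \<Longrightarrow> semicircle n r s \<in> hyp_space n"
  by (auto simp: semicircle_def hyp_space_def topspace_Euclidean_space)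

text \<open>By the addition formula for cosh, the squared Euclidean distance is
  \<open>2 * (cosh (s - t) - 1)\<close> times the product of the two heights, so the quotient in
  \<open>hyp_dist\<close> is \<open>cosh (s - t) - 1\<close>.\<close>

lemma hyp_dist_semicircle:
  assumes "n > 1" "r > 0"
  shows "hyp_dist n (semicircle n r s) (semicircle n r t) = \<bar>s - t\<bar>"
proof -
  have "(\<Sum>i<n. (semicircle n r s i - semicircle n r t i)\<^sup>2) =
        (\<Sum>i\<in>{0,n-1}. (semicircle n r s i - semicircle n r t i)\<^sup>2)"
    using assms by (intro sum.mono_neutral_right) (auto simp: semicircle_def)
  also have "\<dots> = r\<^sup>2 * ((tanh s - tanh t)\<^sup>2 + (1 / cosh s - 1 / cosh t)\<^sup>2)"
    using assms by (simp add: semicircle_def algebra_simps power2_eq_square)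
  finally have *: "(\<Sum>i<n. (semicircle n r s i - semicircle n r t i)\<^sup>2) = \<dots>" .
  have cs: "cosh s * cosh s = 1 + sinh s * sinh s" "cosh t * cosh t = 1 + sinh t * sinh t"
    using cosh_square_eq[of s] cosh_square_eq[of t] by (simp_all add: power2_eq_square)
  have "(tanh s - tanh t)\<^sup>2 + (1 / cosh s - 1 / cosh t)\<^sup>2 =
        2 * (cosh (s - t) - 1) / (cosh s * cosh t)"
  proof -
    have "(tanh s - tanh t)\<^sup>2 + (1 / cosh s - 1 / cosh t)\<^sup>2 =
       ((1 + sinh s * sinh s) / (cosh s * cosh s)) + ((1 + sinh t * sinh t) / (cosh t * cosh t))
       - 2 * (1 + sinh s * sinh t) / (cosh s * cosh t)"
      by (simp add: tanh_def power2_diff power_divide add_divide_distrib)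
        (simp add: power2_eq_square add_divide_distrib)
    also have "\<dots> = 2 * (cosh (s - t) - 1) / (cosh s * cosh t)"
      unfolding cs(1)[symmetric] cs(2)[symmetric] cosh_diff by (simp add: field_simps)
    finally show ?thesis .
  qed
  then have "1 + (\<Sum>i<n. (semicircle n r s i - semicircle n r t i)\<^sup>2) /
        (2 * semicircle n r s (n - 1) * semicircle n r t (n - 1)) = cosh \<bar>s - t\<bar>"
    unfolding * using assms
    by (simp only:) (simp add: semicircle_def power2_eq_square diff_divide_distrib left_diff_distrib)
  then show ?thesis
    unfolding hyp_dist_def by (simp add: arcosh_cosh_real del: cosh_real_abs)
qed

section \<open>Cutting the horizontal coordinates into blocks\<close>

lemma sum_lessThan_blocks:
  fixes h :: "nat \<Rightarrow> 'a::comm_monoid_add" and k :: nat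
  shows "(\<Sum>i<k. \<Sum>j<b i. h ((\<Sum>l<i. b l) + j)) = (\<Sum>i<(\<Sum>l<k. b l). h i)"
proof (induction k)
  case (Suc k)
  have "(\<Sum>i<a + b. h i) = (\<Sum>i<a. h i) + (\<Sum>j<b. h (a + j))" for a b :: nat
    by (induction b) (auto simp: algebra_simps)
  with Suc show ?case
    by simp
qed auto

text \<open>The horizontal coordinates of \<open>H\<^sup>N\<close> are cut into the consecutive blocks of horizontal
  coordinates of the factors, which all receive the same height.\<close>

definition equal_height_map :: "nat \<Rightarrow> (nat \<Rightarrow> nat) \<Rightarrow> (nat \<Rightarrow> real) \<Rightarrow> nat \<Rightarrow> nat \<Rightarrow> real" where
  "equal_height_map k m x = (\<lambda>i\<in>{..<k}. \<lambda>j.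
     if j < m i - 1 then x ((\<Sum>l<i. m l - 1) + j)
     else if j = m i - 1 then x (\<Sum>l<k. m l - 1) else 0)"

context
  fixes k :: nat and m :: "nat \<Rightarrow> nat" and N :: nat
  assumes k: "k > 0" and m: "\<And>i. i < k \<Longrightarrow> m i > 1" and N: "N = Suc (\<Sum>l<k. m l - 1)"
begin

lemma equal_height_map_height:
  "i < k \<Longrightarrow> equal_height_map k m x i (m i - 1) = x (N - 1)"
  by (simp add: equal_height_map_def N)

lemma equal_height_map_in_hyp_space:
  "x \<in> hyp_space N \<Longrightarrow> i < k \<Longrightarrow> equal_height_map k m x i \<in> hyp_space (m i)"
  using m[of i] by (auto simp: hyp_space_def topspace_Euclidean_space equal_height_map_def N)

lemma equal_height_map_in_hyp_prod: "equal_height_map k m \<in> hyp_space N \<rightarrow> hyp_prod k m"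
  using equal_height_map_in_hyp_space
  by (simp add: hyp_prod_def PiE_iff) (simp add: equal_height_map_def)

text \<open>Every factor has the same two heights as the points of \<open>hyp_space N\<close>, so
  the denominators agree with that of \<open>hyp_dist N\<close> and only numerators remain to be
  compared.\<close>

lemma cosh_hyp_dist_equal_height_map:
  assumes "x \<in> hyp_space N" "y \<in> hyp_space N" "i < k"
  shows "cosh (hyp_dist (m i) (equal_height_map k m x i) (equal_height_map k m y i)) =
    1 + ((\<Sum>j<m i - 1. (x ((\<Sum>l<i. m l - 1) + j) - y ((\<Sum>l<i. m l - 1) + j))\<^sup>2)
          + (x (N - 1) - y (N - 1))\<^sup>2) / (2 * x (N - 1) * y (N - 1))"
proof -
  have mi: "m i = Suc (m i - 1)"
    using m[OF assms(3)] by simp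
  have "(\<Sum>j<m i. (equal_height_map k m x i j - equal_height_map k m y i j)\<^sup>2) =
    (\<Sum>j<m i - 1. (x ((\<Sum>l<i. m l - 1) + j) - y ((\<Sum>l<i. m l - 1) + j))\<^sup>2) + (x (N - 1) - y (N - 1))\<^sup>2"
    by (subst mi, subst sum.lessThan_Suc) (use assms(3) in \<open>simp add: equal_height_map_def N\<close>)
  then show ?thesis
    unfolding cosh_hyp_dist[OF assms(1,2)[THEN equal_height_map_in_hyp_space[OF _ assms(3)]]]
    by (simp only: equal_height_map_height[OF assms(3)])
qed

lemma cosh_hyp_dist_blocks:
  assumes "x \<in> hyp_space N" "y \<in> hyp_space N"
  shows "cosh (hyp_dist N x y) =
    1 + ((\<Sum>i<k. \<Sum>j<m i - 1. (x ((\<Sum>l<i. m l - 1) + j) - y ((\<Sum>l<i. m l - 1) + j))\<^sup>2)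
          + (x (N - 1) - y (N - 1))\<^sup>2) / (2 * x (N - 1) * y (N - 1))"
  unfolding cosh_hyp_dist[OF assms]
  by (subst sum_lessThan_blocks[of "\<lambda>i. (x i - y i)\<^sup>2"]) (simp add: N)

lemma hyp_dist_equal_height_map_le:
  assumes "x \<in> hyp_space N" "y \<in> hyp_space N" "i < k"
  shows "hyp_dist (m i) (equal_height_map k m x i) (equal_height_map k m y i) \<le> hyp_dist N x y"
proof -
  have "x (N - 1) > 0" "y (N - 1) > 0"
    using assms by (auto simp: hyp_space_def)
  moreover have "(\<Sum>j<m i - 1. (x ((\<Sum>l<i. m l - 1) + j) - y ((\<Sum>l<i. m l - 1) + j))\<^sup>2) \<le>
    (\<Sum>i<k. \<Sum>j<m i - 1. (x ((\<Sum>l<i. m l - 1) + j) - y ((\<Sum>l<i. m l - 1) + j))\<^sup>2)"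
    using assms(3) by (intro member_le_sum[of i "{..<k}"]) (auto intro: sum_nonneg)
  ultimately have "cosh (hyp_dist (m i) (equal_height_map k m x i) (equal_height_map k m y i))
    \<le> cosh (hyp_dist N x y)"
    unfolding cosh_hyp_dist_equal_height_map[OF assms] cosh_hyp_dist_blocks[OF assms(1,2)]
    by (auto intro!: divide_right_mono)
  then show ?thesis
    by (subst (asm) cosh_real_nonneg_le_iff)
      (auto intro!: hyp_dist_nonneg equal_height_map_in_hyp_space assms)
qed

lemma hyp_dist_le_equal_height_map:
  assumes "x \<in> hyp_space N" "y \<in> hyp_space N"
  shows "hyp_dist N x y \<le>
    hyp_prod_dist k m (equal_height_map k m x) (equal_height_map k m y) + ln (2 * k)"
proof -
  define d where "d i = hyp_dist (m i) (equal_height_map k m x i) (equal_height_map k m y i)" for i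
  define D where "D = hyp_prod_dist k m (equal_height_map k m x) (equal_height_map k m y)"
  have h: "x (N - 1) > 0" "y (N - 1) > 0"
    using assms by (auto simp: hyp_space_def)
  define q where "q i = (\<Sum>j<m i - 1. (x ((\<Sum>l<i. m l - 1) + j) - y ((\<Sum>l<i. m l - 1) + j))\<^sup>2)" for i
  define v where "v = (x (N - 1) - y (N - 1))\<^sup>2"
  \<comment> \<open>The vertical term \<open>v\<close> occurs once in \<open>hyp_space N\<close> but
    once in each of the \<open>k\<close> factors.\<close>
  have "(\<Sum>i<k. q i) + v \<le> (\<Sum>i<k. q i) + k * v"
    using k mult_right_mono[of 1 "real k" v] by (simp add: v_def)
  also have "\<dots> = (\<Sum>i<k. q i + v)"
    by (simp add: sum.distrib)
  finally have "((\<Sum>i<k. q i) + v) / (2 * x (N - 1) * y (N - 1)) \<le>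
      (\<Sum>i<k. q i + v) / (2 * x (N - 1) * y (N - 1))"
    using h by (intro divide_right_mono) auto
  also have "\<dots> = (\<Sum>i<k. cosh (d i) - 1)"
    by (simp add: sum_divide_distrib d_def cosh_hyp_dist_equal_height_map assms q_def v_def)
  finally have "cosh (hyp_dist N x y) \<le> 1 + (\<Sum>i<k. cosh (d i) - 1)"
    unfolding cosh_hyp_dist_blocks[OF assms] q_def v_def by simp
  also have "\<dots> \<le> 1 + (\<Sum>i<k. exp D - 1)"
  proof -
    have "cosh (d i) \<le> exp D" if "i < k" for i
    proof -
      have "d i \<le> D"
        unfolding D_def hyp_prod_dist_def d_def
        by (rule member_le_L2_set[where f = "\<lambda>i. hyp_dist (m i) (equal_height_map k m x i) (equal_height_map k m y i)"])
          (use that in auto)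
      moreover have "d i \<ge> 0"
        unfolding d_def by (intro hyp_dist_nonneg equal_height_map_in_hyp_space assms that)
      ultimately show ?thesis
        using cosh_le_exp_real[of "d i"] by (meson exp_le_cancel_iff order_trans)
    qed
    then show ?thesis
      by (intro add_left_mono sum_mono) auto
  qed
  also have "\<dots> \<le> k * exp D"
    using k by (simp add: algebra_simps)
  finally have "cosh (hyp_dist N x y) \<le> k * exp D" .
  then show ?thesis
    using le_cosh_exp_bound[of "hyp_dist N x y" k D] k by (simp add: D_def)
qed

lemma equal_height_map_quasi_isometric_embedding:
  "quasi_isometric_embedding (hyp_space N) (hyp_dist N) (hyp_prod k m) (hyp_prod_dist k m)
     (equal_height_map k m)"
proof -
  \<comment> \<open>The factor \<open>k\<close> comes from the upper bound, where the L2 norm is at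
    most the sum of \<open>k\<close> distances; the lower bound holds even with factor 1.\<close>
  have "1 / k * hyp_dist N x y - ln (2 * k) \<le>
          hyp_prod_dist k m (equal_height_map k m x) (equal_height_map k m y) \<and>
        hyp_prod_dist k m (equal_height_map k m x) (equal_height_map k m y) \<le>
          k * hyp_dist N x y + ln (2 * k)"
    if xy: "x \<in> hyp_space N" "y \<in> hyp_space N" for x y
  proof
    have "1 / k * hyp_dist N x y \<le> hyp_dist N x y"
      using k hyp_dist_nonneg[OF xy] by (simp add: mult_le_cancel_right1 field_simps)
    then show "1 / k * hyp_dist N x y - ln (2 * k) \<le>
          hyp_prod_dist k m (equal_height_map k m x) (equal_height_map k m y)"
      using hyp_dist_le_equal_height_map[OF xy] by linarith
    have "hyp_prod_dist k m (equal_height_map k m x) (equal_height_map k m y) \<le>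
       (\<Sum>i<k. hyp_dist (m i) (equal_height_map k m x i) (equal_height_map k m y i))"
      unfolding hyp_prod_dist_def
      by (intro L2_set_le_sum hyp_dist_nonneg equal_height_map_in_hyp_space xy) auto
    also have "\<dots> \<le> (\<Sum>i<k. hyp_dist N x y)"
      by (intro sum_mono hyp_dist_equal_height_map_le xy) auto
    also have "\<dots> \<le> k * hyp_dist N x y + ln (2 * k)"
      using k by simp
    finally show "hyp_prod_dist k m (equal_height_map k m x) (equal_height_map k m y) \<le>
          k * hyp_dist N x y + ln (2 * k)" .
  qed
  moreover have "real k \<ge> 1" "ln (2 * k) \<ge> 0"
    using k by auto
  ultimately show ?thesis
    unfolding quasi_isometric_embedding_def using equal_height_map_in_hyp_prod by blast
qed

text \<open>A semicircle in one factor, constant in the others, joins two points of the image; the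
  heights of this factor and of another one drift apart by an arbitrary amount.\<close>

lemma equal_height_map_not_quasiconvex:
  assumes "k > 1"
  shows "\<not> quasiconvex (hyp_prod k m) (hyp_prod_dist k m) (equal_height_map k m ` hyp_space N)"
proof
  assume "quasiconvex (hyp_prod k m) (hyp_prod_dist k m) (equal_height_map k m ` hyp_space N)"
  then obtain D where D: "D \<ge> 0" and
    qc': "\<forall>p\<in>equal_height_map k m ` hyp_space N. \<forall>q\<in>equal_height_map k m ` hyp_space N. \<forall>L c.
       geodesic_between (hyp_prod k m) (hyp_prod_dist k m) p q L c \<longrightarrow>
       (\<forall>t\<in>{0..L}. \<exists>y\<in>equal_height_map k m ` hyp_space N. hyp_prod_dist k m (c t) y \<le> D)"
    unfolding quasiconvex_def by (elim conjE exE)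
  have qc: "\<exists>y\<in>hyp_space N. hyp_prod_dist k m (c t) (equal_height_map k m y) \<le> D"
    if "p \<in> hyp_space N" "q \<in> hyp_space N" "t \<in> {0..L}"
      "geodesic_between (hyp_prod k m) (hyp_prod_dist k m) (equal_height_map k m p) (equal_height_map k m q) L c"
    for p q L c t
    using qc'[rule_format, OF imageI imageI, OF that(1,2,4,3)] by auto
  \<comment> \<open>Two heights within \<open>D\<close> of a common logarithmic height force
    \<open>ln (cosh S)\<close> to be at most \<open>2 * D\<close>, whereas
    \<open>ln (cosh S)\<close> is at least \<open>S - ln 2\<close>, which exceeds
    \<open>2 * D\<close> for this \<open>S\<close>.\<close>
  define S where "S = 2 * D + 2"
  \<comment> \<open>With radius \<open>cosh S\<close> the semicircle has height 1 exactly at its two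
    ends, the parameters \<open>0\<close> and \<open>2 * S\<close>. The other factors stay at the
    point of height 1 above the origin, so both ends lie in the image.\<close>
  define c where "c u = (\<lambda>i\<in>{..<k}. if i = 0 then semicircle (m 0) (cosh S) (u - S) else semicircle (m i) 1 0)" for u
  \<comment> \<open>The preimages of the ends of \<open>c\<close>: height 1, displaced only in
    coordinate \<open>0\<close>, the first coordinate of the first block.\<close>
  define p where "p u = (\<lambda>j. 0)(0 := cosh S * tanh u, N - 1 := 1 :: real)" for u
  have N1: "N > 1"
  proof -
    have "m 0 - 1 \<le> (\<Sum>l<k. m l - 1)"
      using k by (intro member_le_sum[of 0 "{..<k}" "\<lambda>l. m l - 1"]) auto
    with m[OF k] N show ?thesis
      by simp
  qed
  have p: "p u \<in> hyp_space N" for u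
    using N1 by (auto simp: p_def hyp_space_def topspace_Euclidean_space)
  have Fp: "equal_height_map k m (p u) = c (u + S)" if "u = S \<or> u = - S" for u
  proof (intro ext)
    fix i j
    \<comment> \<open>Blocks after the first start beyond coordinate \<open>0\<close>, and no block
      reaches the height coordinate \<open>N - 1\<close>; hence \<open>p u\<close> is seen
      horizontally only in the first factor.\<close>
    have "(\<Sum>l<i. m l - 1) > 0" if "i > 0" "i < k"
    proof -
      have "m 0 - 1 \<le> (\<Sum>l<i. m l - 1)"
        using that by (intro member_le_sum[of 0 "{..<i}" "\<lambda>l. m l - 1"]) auto
      with m[OF k] show ?thesis
        by simp
    qed
    moreover have "(\<Sum>l<i. m l - 1) + j < N - 1" if "i < k" "j < m i - 1"
    proof -
      have "(\<Sum>l<i. m l - 1) + (m i - 1) = (\<Sum>l<Suc i. m l - 1)"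
        by simp
      also have "\<dots> \<le> (\<Sum>l<k. m l - 1)"
        using that by (intro sum_mono2) auto
      finally show ?thesis
        using that N by simp
    qed
    ultimately show "equal_height_map k m (p u) i j = c (u + S) i j"
      using that m[of i] m[OF k] N N1
      by (auto simp: equal_height_map_def c_def p_def semicircle_def)
  qed
  have "geodesic_between (hyp_prod k m) (hyp_prod_dist k m) (equal_height_map k m (p (- S)))
      (equal_height_map k m (p S)) (2 * S) c"
    unfolding geodesic_between_def
  proof (intro conjI ballI)
    show "2 * S \<ge> 0"
      using D by (simp add: S_def)
    show "c \<in> {0..2 * S} \<rightarrow> hyp_prod k m"
      using m by (auto simp: hyp_prod_def c_def intro!: semicircle_in_hyp_space)
    show "c 0 = equal_height_map k m (p (- S))" "c (2 * S) = equal_height_map k m (p S)"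
      by (simp_all add: Fp)
    fix s t
    have "hyp_prod_dist k m (c s) (c t) = L2_set (\<lambda>i. if i = 0 then \<bar>s - t\<bar> else 0) {..<k}"
      unfolding hyp_prod_dist_def
      by (rule L2_set_cong) (use m k in \<open>auto simp: c_def hyp_dist_semicircle hyp_dist_self\<close>)
    also have "\<dots> = \<bar>s - t\<bar>"
      using k by (simp add: L2_set_def if_distrib[of power2] cong: if_cong)
    finally show "hyp_prod_dist k m (c s) (c t) = \<bar>s - t\<bar>" .
  qed
  \<comment> \<open>The parameter \<open>S\<close> is the apex, where the first factor has height
    \<open>cosh S\<close> and all others have height 1.\<close>
  from qc[OF p p _ this, of S] D obtain y where y: "y \<in> hyp_space N"
    and yD: "hyp_prod_dist k m (c S) (equal_height_map k m y) \<le> D"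
    by (auto simp: S_def)
  have le_D: "\<bar>ln (c S i (m i - 1)) - ln (y (N - 1))\<bar> \<le> D" if "i < k" for i
  proof -
    have "hyp_dist (m i) (c S i) (equal_height_map k m y i) \<le> D"
      using yD member_le_L2_set[of "{..<k}" i "\<lambda>i. hyp_dist (m i) (c S i) (equal_height_map k m y i)"] that
      unfolding hyp_prod_dist_def by simp
    moreover have "c S i \<in> hyp_space (m i)"
      using that m by (auto simp: c_def intro!: semicircle_in_hyp_space)
    ultimately show ?thesis
      using hyp_dist_ge_ln_height[of "c S i" "m i" "equal_height_map k m y i"] m[OF that]
        equal_height_map_in_hyp_space[OF y that] equal_height_map_height[OF that]
      by force
  qed
  have "ln (cosh S) \<le> 2 * D"
    using le_D[of 0] le_D[of 1] assms by (simp add: c_def semicircle_def)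
  moreover have "S \<le> ln (cosh S) + ln 2"
    using le_cosh_exp_bound[of S 1 "ln (cosh S)"] by simp
  moreover have "ln 2 < (2::real)"
    using ln_less_self[of 2] by simp
  ultimately show False
    by (simp add: S_def)
qed

end

section \<open>Hyperbolic space as a solvable Lie group\<close>

text \<open>A class closed under partial derivatives that contains the coordinate formulas of the
  group operations and of the metric, so that smoothness reduces to membership. Signs and case
  distinctions on indices enter through the constants.\<close>

inductive exp_polynomial :: "((nat \<Rightarrow> real) \<Rightarrow> real) \<Rightarrow> bool" where
  const: "exp_polynomial (\<lambda>x. c)"
| coord: "exp_polynomial (\<lambda>x. x i)"
| add: "exp_polynomial f \<Longrightarrow> exp_polynomial g \<Longrightarrow> exp_polynomial (\<lambda>x. f x + g x)"
| mult: "exp_polynomial f \<Longrightarrow> exp_polynomial g \<Longrightarrow> exp_polynomial (\<lambda>x. f x * g x)"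
| exp: "exp_polynomial f \<Longrightarrow> exp_polynomial (\<lambda>x. exp (f x))"

text \<open>Structural induction by the rules of differentiation. One \<open>f'\<close> serves all
  points, which makes the partial derivative itself a member of the class.\<close>

lemma exp_polynomial_has_derivative:
  assumes "exp_polynomial f"
  shows "\<exists>f'. exp_polynomial f' \<and> (\<forall>x. ((\<lambda>t. f (x(i := t))) has_real_derivative f' x) (at (x i)))"
  using assms
proof induction
  case (const c)
  then show ?case
    by (intro exI[of _ "\<lambda>_. 0"]) (auto intro: exp_polynomial.const)
next
  case (coord j)
  then show ?case
    by (intro exI[of _ "\<lambda>_. if i = j then 1 else 0"]) (auto intro: exp_polynomial.const)
next
  case (add f g)
  then obtain f' g' where *: "exp_polynomial f'" "exp_polynomial g'"
    and d: "\<And>x. ((\<lambda>t. f (x(i := t))) has_real_derivative f' x) (at (x i))"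
      "\<And>x. ((\<lambda>t. g (x(i := t))) has_real_derivative g' x) (at (x i))"
    by metis
  show ?case
    by (intro exI[of _ "\<lambda>x. f' x + g' x"] conjI allI exp_polynomial.add DERIV_add * d)
next
  case (mult f g)
  then obtain f' g' where *: "exp_polynomial f'" "exp_polynomial g'"
    and d: "\<And>x. ((\<lambda>t. f (x(i := t))) has_real_derivative f' x) (at (x i))"
      "\<And>x. ((\<lambda>t. g (x(i := t))) has_real_derivative g' x) (at (x i))"
    by metis
  have "((\<lambda>t. f (x(i := t)) * g (x(i := t))) has_real_derivative f' x * g x + g' x * f x) (at (x i))" for x
    using DERIV_mult[OF d(1)[of x] d(2)[of x]] by simp
  with * mult.hyps show ?case
    by (intro exI[of _ "\<lambda>x. f' x * g x + g' x * f x"] conjI allI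
        exp_polynomial.add exp_polynomial.mult)
next
  case (exp f)
  then obtain f' where *: "exp_polynomial f'"
    and d: "\<And>x. ((\<lambda>t. f (x(i := t))) has_real_derivative f' x) (at (x i))"
    by metis
  have "((\<lambda>t. exp (f (x(i := t)))) has_real_derivative exp (f x) * f' x) (at (x i))" for x
    using DERIV_chain'[OF d DERIV_exp, of x] by (simp add: mult.commute)
  with * exp.hyps show ?case
    by (intro exI[of _ "\<lambda>x. exp (f x) * f' x"] conjI allI
        exp_polynomial.exp exp_polynomial.mult)
qed

lemma exp_polynomial_partial_deriv:
  assumes "exp_polynomial f"
  shows "exp_polynomial (partial_deriv i f)" "(\<lambda>t. f (x(i := t))) differentiable at (x i)"
proof -
  obtain f' where f': "exp_polynomial f'"
    "\<And>x. ((\<lambda>t. f (x(i := t))) has_real_derivative f' x) (at (x i))"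
    using exp_polynomial_has_derivative[OF assms] by blast
  then have "partial_deriv i f = f'"
    by (auto simp: partial_deriv_def fun_eq_iff intro: DERIV_imp_deriv)
  with f' show "exp_polynomial (partial_deriv i f)" "(\<lambda>t. f (x(i := t))) differentiable at (x i)"
    by (auto simp: real_differentiable_def)
qed

lemma exp_polynomial_continuous_on: "exp_polynomial f \<Longrightarrow> continuous_on UNIV f"
  by (induction rule: exp_polynomial.induct)
    (auto intro!: continuous_intros continuous_on_product_coordinates)

lemma fun_upd_in_Euclidean_space:
  "x \<in> topspace (Euclidean_space n) \<Longrightarrow> i < n \<Longrightarrow> x(i := t) \<in> topspace (Euclidean_space n)"
  by (auto simp: topspace_Euclidean_space)

lemma partial_deriv_cong:
  assumes "\<And>x. x \<in> topspace (Euclidean_space n) \<Longrightarrow> f x = g x"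
    and "x \<in> topspace (Euclidean_space n)" "i < n"
  shows "partial_deriv i f x = partial_deriv i g x"
  unfolding partial_deriv_def using assms fun_upd_in_Euclidean_space by simp

text \<open>Agreement is asked only on the Euclidean space, as chart inverses and group inverses are
  known only there. Changing a coordinate below \<open>n\<close> stays in this space, so the
  agreement passes to all iterated partial derivatives.\<close>

lemma smooth_fun_exp_polynomial:
  assumes "U \<subseteq> topspace (Euclidean_space n)" and g: "exp_polynomial g"
    and eq: "\<And>x. x \<in> topspace (Euclidean_space n) \<Longrightarrow> f x = g x"
  shows "smooth_fun n U f"
proof -
  have *: "exp_polynomial (foldr partial_deriv is g) \<and>
      (\<forall>x\<in>topspace (Euclidean_space n). foldr partial_deriv is f x = foldr partial_deriv is g x)"
    if "set is \<subseteq> {..<n}" for "is"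
    using that
  proof (induction "is")
    case (Cons i "is")
    then show ?case
      by (auto intro: exp_polynomial_partial_deriv partial_deriv_cong)
  qed (use g eq in auto)
  show ?thesis
    unfolding smooth_fun_def
  proof (intro allI impI conjI ballI)
    fix "is" :: "nat list"
    assume "set is \<subseteq> {..<n}"
    note h = *[OF this]
    have "continuous_map (Euclidean_space n) euclideanreal (foldr partial_deriv is g)"
      unfolding continuous_map_Euclidean_space_iff
      using h exp_polynomial_continuous_on continuous_on_subset by blast
    then have "continuous_map (Euclidean_space n) euclideanreal (foldr partial_deriv is f)"
      by (rule continuous_map_eq) (use h in auto)
    then show "continuous_map (subtopology (Euclidean_space n) U) euclideanreal (foldr partial_deriv is f)"
      by (rule continuous_map_from_subtopology)
    fix i x
    assume "i < n" "x \<in> U"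
    then have "(\<lambda>t. foldr partial_deriv is f (x(i := t))) = (\<lambda>t. foldr partial_deriv is g (x(i := t)))"
      using h assms(1) fun_upd_in_Euclidean_space by blast
    then show "(\<lambda>t. foldr partial_deriv is f (x(i := t))) differentiable at (x i)"
      using h exp_polynomial_partial_deriv by simp
  qed
qed

section \<open>Euclidean space as a manifold with one global chart\<close>

definition id_chart :: "nat \<Rightarrow> (nat \<Rightarrow> real) chart" where
  "id_chart n = (topspace (Euclidean_space n), \<lambda>x. x)"

lemma id_chart_simps [simp]:
  "fst (id_chart n) = topspace (Euclidean_space n)" "snd (id_chart n) x = x"
  "x \<in> topspace (Euclidean_space n) \<Longrightarrow> chart_inv (id_chart n) x = x"
  by (auto simp: id_chart_def chart_inv_def inv_into_f_eq)

lemma second_countable_Euclidean_space: "second_countable (Euclidean_space n)"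
proof -
  obtain B :: "(nat \<Rightarrow> real) set set" where B: "countable B" "topological_basis B"
    using ex_countable_basis by blast
  have "second_countable (euclidean :: (nat \<Rightarrow> real) topology)"
    unfolding second_countable_def
  proof (intro exI[of _ B] conjI ballI allI impI)
    show "countable B"
      by (rule B)
    show "openin euclidean V" if "V \<in> B" for V
      using that B(2) by (simp add: topological_basis_open)
    show "\<exists>V\<in>B. x \<in> V \<and> V \<subseteq> U" if "openin euclidean U \<and> x \<in> U" for U x
      using that topological_basisE[OF B(2), of U x] by (metis open_openin)
  qed
  then show ?thesis
    by (simp add: Euclidean_space_def euclidean_product_topology second_countable_subtopology)
qed

lemma smooth_manifold_id_chart: "smooth_manifold n (Euclidean_space n) {id_chart n}"
proof -
  have "snd (id_chart n) = id"
    by auto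
  moreover have "smooth_fun n (topspace (Euclidean_space n)) (\<lambda>x. chart_inv (id_chart n) x j)" for j
    by (rule smooth_fun_exp_polynomial[OF _ exp_polynomial.coord]) auto
  ultimately show ?thesis
    by (simp add: smooth_manifold_def is_chart_def Hausdorff_Euclidean_space
        second_countable_Euclidean_space)
qed

lemma jacobian_id_chart:
  assumes "p \<in> topspace (Euclidean_space n)" "i < n"
  shows "jacobian (id_chart n) (id_chart n) f p a i = partial_deriv i (\<lambda>x. f x a) p"
  unfolding jacobian_def id_chart_simps
  by (rule partial_deriv_cong[OF _ assms]) auto

lemma partial_deriv_affine:
  assumes "\<And>x. f x = b + c * x a"
  shows "partial_deriv i f p = (if a = i then c else 0)"
  unfolding partial_deriv_def
  by (rule DERIV_imp_deriv) (auto simp: assms intro!: derivative_eq_intros)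

lemma chart_inv_prod_chart:
  assumes "x \<in> topspace (Euclidean_space (n + n))"
  shows "chart_inv (prod_chart n (id_chart n) (id_chart n)) x =
    (\<lambda>i. if i < n then x i else 0, \<lambda>i. x (i + n))"
  unfolding chart_inv_def
proof (rule inv_into_f_eq)
  show "inj_on (snd (prod_chart n (id_chart n) (id_chart n))) (fst (prod_chart n (id_chart n) (id_chart n)))"
    by (rule inj_on_inverseI[of _ "\<lambda>x. (\<lambda>i. if i < n then x i else 0, \<lambda>i. x (i + n))"])
      (auto simp: prod_chart_def topspace_Euclidean_space fun_eq_iff)
qed (use assms in \<open>auto simp: prod_chart_def topspace_Euclidean_space\<close>)

text \<open>Real hyperbolic space as the group of its dilations and horizontal translations, where
  \<open>x (n - 1)\<close> is the logarithm of the height.\<close>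

definition hyp_group :: "nat \<Rightarrow> (nat \<Rightarrow> real) monoid" where
  "hyp_group n = \<lparr>carrier = topspace (Euclidean_space n),
     monoid.mult = (\<lambda>x y i. if i < n - 1 then x i + exp (x (n - 1)) * y i else x i + y i),
     one = (\<lambda>i. 0)\<rparr>"

text \<open>The matrix of \<open>dt^2 + exp (- 2 * t) dx^2\<close> with
  \<open>t = p (n - 1)\<close>: the hyperbolic metric written with the logarithm of the
  height.\<close>

definition hyp_group_metric ::
  "nat \<Rightarrow> (nat \<Rightarrow> real) chart \<Rightarrow> (nat \<Rightarrow> real) \<Rightarrow> nat \<Rightarrow> nat \<Rightarrow> real" where
  "hyp_group_metric n c p i j =
     (if i = j then if i = n - 1 then 1 else exp (- 2 * p (n - 1)) else 0)"

lemma hyp_group_simps [simp]: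
  "carrier (hyp_group n) = topspace (Euclidean_space n)"
  "(x \<otimes>\<^bsub>hyp_group n\<^esub> y) i = (if i < n - 1 then x i + exp (x (n - 1)) * y i else x i + y i)"
  "\<one>\<^bsub>hyp_group n\<^esub> = (\<lambda>i. 0)"
  by (simp_all add: hyp_group_def)

section \<open>Group laws and solvability\<close>

lemma hyp_group_mult_closed:
  "x \<in> topspace (Euclidean_space n) \<Longrightarrow> y \<in> topspace (Euclidean_space n) \<Longrightarrow>
    x \<otimes>\<^bsub>hyp_group n\<^esub> y \<in> topspace (Euclidean_space n)"
  by (auto simp: topspace_Euclidean_space)

lemma hyp_group_inv_aux:
  fixes x and n :: nat
  defines "y \<equiv> \<lambda>i. if i < n - 1 then - (exp (- x (n - 1)) * x i) else - x i"
  assumes "x \<in> topspace (Euclidean_space n)"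
  shows "y \<in> carrier (hyp_group n)" "y \<otimes>\<^bsub>hyp_group n\<^esub> x = \<one>\<^bsub>hyp_group n\<^esub>"
  using assms by (auto simp: topspace_Euclidean_space fun_eq_iff)

lemma group_hyp_group: "group (hyp_group n)"
proof (rule groupI)
  fix x
  assume "x \<in> carrier (hyp_group n)"
  then show "\<exists>y\<in>carrier (hyp_group n). y \<otimes>\<^bsub>hyp_group n\<^esub> x = \<one>\<^bsub>hyp_group n\<^esub>"
    using hyp_group_inv_aux[of x n] by auto
qed (auto simp: hyp_group_mult_closed fun_eq_iff topspace_Euclidean_space exp_add algebra_simps)

lemma hyp_group_inv:
  assumes "x \<in> topspace (Euclidean_space n)"
  shows "inv\<^bsub>hyp_group n\<^esub> x = (\<lambda>i. if i < n - 1 then - (exp (- x (n - 1)) * x i) else - x i)"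
  using group.inv_equality[OF group_hyp_group hyp_group_inv_aux(2)] hyp_group_inv_aux(1) assms
  by simp

text \<open>The last coordinate is additive under the group law, so commutators lie in the subgroup
  \<open>H\<close> of horizontal translations. On \<open>H\<close> the law is plain addition, hence
  commutative, and the second derived subgroup is trivial.\<close>

lemma solvable_hyp_group: "solvable (hyp_group n)"
proof -
  interpret group "hyp_group n"
    by (rule group_hyp_group)
  define H where "H = {x \<in> carrier (hyp_group n). x (n - 1) = 0}"
  have "subgroup H (hyp_group n)"
    by (rule subgroupI) (auto simp: H_def hyp_group_inv topspace_Euclidean_space)
  moreover have "derived_set (hyp_group n) (carrier (hyp_group n)) \<subseteq> H"
  proof clarify
    fix x y
    assume "x \<in> carrier (hyp_group n)" "y \<in> carrier (hyp_group n)"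
    moreover from this have "x \<otimes>\<^bsub>hyp_group n\<^esub> y \<otimes>\<^bsub>hyp_group n\<^esub> inv\<^bsub>hyp_group n\<^esub> x \<otimes>\<^bsub>hyp_group n\<^esub> inv\<^bsub>hyp_group n\<^esub> y
        \<in> carrier (hyp_group n)"
      by (intro m_closed inv_closed)
    ultimately show "x \<otimes>\<^bsub>hyp_group n\<^esub> y \<otimes>\<^bsub>hyp_group n\<^esub> inv\<^bsub>hyp_group n\<^esub> x \<otimes>\<^bsub>hyp_group n\<^esub> inv\<^bsub>hyp_group n\<^esub> y \<in> H"
      by (simp add: H_def hyp_group_inv)
  qed
  ultimately have der: "derived (hyp_group n) (carrier (hyp_group n)) \<subseteq> H"
    unfolding derived_def by (intro generate_subgroup_incl)
  have "derived_set (hyp_group n) H \<subseteq> {\<one>\<^bsub>hyp_group n\<^esub>}"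
    by (auto simp: H_def hyp_group_inv fun_eq_iff)
  then have "derived (hyp_group n) H \<subseteq> {\<one>\<^bsub>hyp_group n\<^esub>}"
    unfolding derived_def using generate_subgroup_incl triv_subgroup by blast
  then have "derived (hyp_group n) (derived (hyp_group n) (carrier (hyp_group n))) \<subseteq> {\<one>\<^bsub>hyp_group n\<^esub>}"
    using mono_derived[OF der] by blast
  moreover have "subgroup (derived (hyp_group n) (derived (hyp_group n) (carrier (hyp_group n)))) (hyp_group n)"
    by (intro derived_is_subgroup derived_in_carrier subset_refl)
  ultimately have "derived (hyp_group n) (derived (hyp_group n) (carrier (hyp_group n))) = {\<one>\<^bsub>hyp_group n\<^esub>}"
    using subgroup.one_closed by blast
  then show ?thesis
    unfolding solvable_iff_trivial_derived_seq by (intro exI[of _ 2]) (simp add: numeral_2_eq_2)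
qed

section \<open>Smoothness of the group operations\<close>

lemma continuous_map_Euclidean_space_coordinate:
  "continuous_map (Euclidean_space n) euclideanreal (\<lambda>x. x i)"
  unfolding continuous_map_Euclidean_space_iff
  by (intro continuous_on_subset[OF continuous_on_product_coordinates] subset_UNIV)

lemma continuous_map_exp:
  "continuous_map X euclideanreal f \<Longrightarrow> continuous_map X euclideanreal (\<lambda>x. exp (f x :: real))"
  using continuous_map_compose[of X euclideanreal f euclideanreal exp]
  by (simp add: o_def continuous_on_exp continuous_on_id)

lemma prod_atlas_singleton: "prod_atlas n {c} {c'} = {prod_chart n c c'}"
  unfolding prod_atlas_def by blast

lemma smooth_map_hyp_group_mult:
  assumes "n > 0"
  shows "smooth_map (n + n) (prod_topology (Euclidean_space n) (Euclidean_space n))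
    (prod_atlas n {id_chart n} {id_chart n}) n (Euclidean_space n) {id_chart n}
    (\<lambda>(x, y). x \<otimes>\<^bsub>hyp_group n\<^esub> y)"
proof -
  let ?T = "prod_topology (Euclidean_space n) (Euclidean_space n)"
  have co: "continuous_map ?T euclideanreal (\<lambda>p. fst p i)" "continuous_map ?T euclideanreal (\<lambda>p. snd p i)" for i
    using continuous_map_compose[OF continuous_map_fst continuous_map_Euclidean_space_coordinate]
      continuous_map_compose[OF continuous_map_snd continuous_map_Euclidean_space_coordinate]
    by (auto simp: o_def)
  \<comment> \<open>The componentwise criterion for continuity expects the value 0 from index
    \<open>n\<close> on to be written out.\<close>
  have "continuous_map ?T (Euclidean_space n) (\<lambda>p i. if i < n then (fst p \<otimes>\<^bsub>hyp_group n\<^esub> snd p) i else 0)"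
    unfolding continuous_map_componentwise_Euclidean_space hyp_group_simps
    by (auto intro!: continuous_map_add continuous_map_real_mult continuous_map_exp co)
  then have "continuous_map ?T (Euclidean_space n) (\<lambda>(x, y). x \<otimes>\<^bsub>hyp_group n\<^esub> y)"
    by (rule continuous_map_eq) (auto simp: fun_eq_iff topspace_Euclidean_space)
  moreover have "smooth_fun (n + n)
      (snd c ` (fst c \<inter> (\<lambda>(x, y). x \<otimes>\<^bsub>hyp_group n\<^esub> y) -` topspace (Euclidean_space n)))
      (\<lambda>x. (case chart_inv c x of (x, y) \<Rightarrow> x \<otimes>\<^bsub>hyp_group n\<^esub> y) j)"
    if c: "c = prod_chart n (id_chart n) (id_chart n)" and j: "j < n" for c j
  proof (rule smooth_fun_exp_polynomial)
    show "snd c ` (fst c \<inter> (\<lambda>(x, y). x \<otimes>\<^bsub>hyp_group n\<^esub> y) -` topspace (Euclidean_space n))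
        \<subseteq> topspace (Euclidean_space (n + n))"
      by (auto simp: c prod_chart_def topspace_Euclidean_space)
    \<comment> \<open>For the last coordinate the coefficient 0 turns the exponential into 1, so one
      formula covers both cases of the product. Index \<open>j + n\<close> reads coordinate
      \<open>j\<close> of the second factor.\<close>
    show "exp_polynomial (\<lambda>x. x j + exp ((if j < n - 1 then 1 else 0) * x (n - 1)) * x (j + n))"
      by (intro exp_polynomial.intros)
    show "(case chart_inv c x of (x, y) \<Rightarrow> x \<otimes>\<^bsub>hyp_group n\<^esub> y) j =
        x j + exp ((if j < n - 1 then 1 else 0) * x (n - 1)) * x (j + n)"
      if "x \<in> topspace (Euclidean_space (n + n))" for x
      using that j by (simp add: c chart_inv_prod_chart)
  qed
  ultimately show ?thesis
    by (simp add: smooth_map_def prod_atlas_singleton)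
qed

lemma smooth_map_hyp_group_inv:
  assumes "n > 0"
  shows "smooth_map n (Euclidean_space n) {id_chart n} n (Euclidean_space n) {id_chart n}
    (\<lambda>x. inv\<^bsub>hyp_group n\<^esub> x)"
proof -
  have "continuous_map (Euclidean_space n) (Euclidean_space n)
      (\<lambda>x i. if i < n then if i < n - 1 then - (exp (- x (n - 1)) * x i) else - x i else 0)"
    unfolding continuous_map_componentwise_Euclidean_space
    by (auto intro!: continuous_map_minus continuous_map_real_mult continuous_map_exp
        continuous_map_Euclidean_space_coordinate)
  then have "continuous_map (Euclidean_space n) (Euclidean_space n) (\<lambda>x. inv\<^bsub>hyp_group n\<^esub> x)"
    by (rule continuous_map_eq) (auto simp: fun_eq_iff hyp_group_inv, auto simp: topspace_Euclidean_space)
  moreover have "smooth_fun n U (\<lambda>x. (inv\<^bsub>hyp_group n\<^esub> (chart_inv (id_chart n) x)) j)"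
    if "U \<subseteq> topspace (Euclidean_space n)" for U j
  proof (rule smooth_fun_exp_polynomial[OF that])
    show "exp_polynomial (\<lambda>x. (- 1) * (exp ((if j < n - 1 then - 1 else 0) * x (n - 1)) * x j))"
      by (intro exp_polynomial.intros)
  qed (simp add: hyp_group_inv)
  ultimately show ?thesis
    by (auto simp: smooth_map_def image_def)
qed

lemma lie_group_hyp_group: "n > 0 \<Longrightarrow> lie_group n (hyp_group n) (Euclidean_space n) {id_chart n}"
  by (simp add: lie_group_def group_hyp_group smooth_manifold_id_chart smooth_map_hyp_group_mult
      smooth_map_hyp_group_inv)

section \<open>The left-invariant Riemannian metric\<close>

lemma preserves_metric_diagonal:
  assumes "\<And>p i. p \<in> topspace (Euclidean_space n) \<Longrightarrow> i < n \<Longrightarrow>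
      hyp_group_metric n (id_chart n) p i i = hyp_group_metric n (id_chart n) (f p) i i * (u i)\<^sup>2"
    and "\<And>x a. a < n \<Longrightarrow> f x a = b a + u a * x a"
  shows "preserves_metric n {id_chart n} (hyp_group_metric n) f"
proof -
  have "hyp_group_metric n (id_chart n) p i j = (\<Sum>a<n. \<Sum>b<n. hyp_group_metric n (id_chart n) (f p) a b *
      jacobian (id_chart n) (id_chart n) f p a i * jacobian (id_chart n) (id_chart n) f p b j)"
    if p: "p \<in> topspace (Euclidean_space n)" and ij: "i < n" "j < n" for p i j
  proof -
    let ?g = "hyp_group_metric n (id_chart n) (f p)"
    \<comment> \<open>A map that is affine in each coordinate separately has a constant diagonal
      Jacobian, so the pulled-back diagonal metric has to be compared on the diagonal only.\<close>
    have jac: "jacobian (id_chart n) (id_chart n) f p a l = (if a = l then u a else 0)"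
      if "a < n" "l < n" for a l
      using jacobian_id_chart[OF p that(2)] partial_deriv_affine[OF assms(2)[OF that(1)]] by simp
    have "(\<Sum>a<n. \<Sum>b<n. ?g a b * jacobian (id_chart n) (id_chart n) f p a i * jacobian (id_chart n) (id_chart n) f p b j) =
        (\<Sum>a<n. \<Sum>b<n. if b = j then (if a = i then ?g i j * u i * u j else 0) else 0)"
      using ij by (intro sum.cong refl) (auto simp: jac)
    also have "\<dots> = ?g i j * u i * u j"
      using ij by simp
    also have "\<dots> = hyp_group_metric n (id_chart n) p i j"
      using assms(1)[OF p ij(1)] by (cases "i = j") (auto simp: hyp_group_metric_def power2_eq_square)
    finally show ?thesis
      by simp
  qed
  then show ?thesis
    by (simp add: preserves_metric_def)
qed

text \<open>Left translation by \<open>a\<close> scales the horizontal coordinates by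
  \<open>exp (a (n - 1))\<close> and shifts the logarithmic height by \<open>a (n - 1)\<close>; the
  factor \<open>exp (- 2 * t)\<close> of the metric compensates the scaling.\<close>

lemma left_invariant_hyp_group:
  assumes "n > 0"
  shows "left_invariant n (hyp_group n) {id_chart n} (hyp_group_metric n)"
  unfolding left_invariant_def
proof
  fix a
  show "preserves_metric n {id_chart n} (hyp_group_metric n) (\<lambda>x. a \<otimes>\<^bsub>hyp_group n\<^esub> x)"
    by (rule preserves_metric_diagonal[where b = a and u = "\<lambda>i. if i < n - 1 then exp (a (n - 1)) else 1"])
      (use assms in \<open>auto simp: hyp_group_metric_def power2_eq_square simp flip: exp_add\<close>)
qed

lemma sum_hyp_group_metric:
  "(\<Sum>i<n. \<Sum>j<n. hyp_group_metric n c p i j * v i * v j) =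
   (\<Sum>i<n. (if i = n - 1 then 1 else exp (- 2 * p (n - 1))) * (v i)\<^sup>2)"
proof (rule sum.cong[OF refl])
  fix i
  assume "i \<in> {..<n}"
  moreover have "(\<Sum>j<n. hyp_group_metric n c p i j * v i * v j) =
      (\<Sum>j<n. if j = i then (if i = n - 1 then 1 else exp (- 2 * p (n - 1))) * (v i)\<^sup>2 else 0)"
    by (intro sum.cong refl) (auto simp: hyp_group_metric_def power2_eq_square)
  ultimately show "(\<Sum>j<n. hyp_group_metric n c p i j * v i * v j) =
      (if i = n - 1 then 1 else exp (- 2 * p (n - 1))) * (v i)\<^sup>2"
    by simp
qed

lemma riemannian_metric_hyp_group: "riemannian_metric n {id_chart n} (hyp_group_metric n)"
proof -
  have pos: "0 < (\<Sum>i<n. \<Sum>j<n. hyp_group_metric n c p i j * v i * v j)" if "i < n" "v i \<noteq> 0" for c p v i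
    unfolding sum_hyp_group_metric by (rule sum_pos2[of _ i]) (use that in auto)
  have smooth: "smooth_fun n (topspace (Euclidean_space n))
      (\<lambda>x. hyp_group_metric n (id_chart n) (chart_inv (id_chart n) x) i j)" for i j
  proof (rule smooth_fun_exp_polynomial)
    \<comment> \<open>The coefficient 0 in the exponent produces the vertical entry 1, and the
      coefficient 0 in front the off-diagonal entries.\<close>
    show "exp_polynomial (\<lambda>x. (if i = j then 1 else 0) * exp ((if i = n - 1 then 0 else - 2) * x (n - 1)))"
      by (intro exp_polynomial.intros)
  qed (auto simp: hyp_group_metric_def)
  have pres: "preserves_metric n {id_chart n} (hyp_group_metric n) (\<lambda>p. p)"
    by (rule preserves_metric_diagonal[where b = "\<lambda>_. 0" and u = "\<lambda>_. 1"]) auto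
  have sym: "hyp_group_metric n c p i j = hyp_group_metric n c p j i" for c p i j
    by (auto simp: hyp_group_metric_def)
  show ?thesis
    unfolding riemannian_metric_def using pres sym by (auto simp: smooth intro: pos)
qed

section \<open>Lengths of curves\<close>

text \<open>Induction on the break points: if the new one is interior, the interval is cut there,
  and no piece of either half has it in its interior.\<close>

lemma integrable_on_finite_breaks:
  fixes h :: "real \<Rightarrow> real"
  assumes "finite F" "a \<le> b"
    and "\<And>s t. a \<le> s \<Longrightarrow> s < t \<Longrightarrow> t \<le> b \<Longrightarrow> {s<..<t} \<inter> F = {} \<Longrightarrow> h integrable_on {s..t}"
  shows "h integrable_on {a..b}"
  using assms
proof (induction F arbitrary: a b)
  case empty
  show ?case
    using empty.prems(1) empty.prems(2)[of a b] integrable_on_refl[of h a] by (cases "a = b") auto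
next
  case (insert x F)
  show ?case
  proof (cases "a < x \<and> x < b")
    case True
    have "h integrable_on {a..x}"
      by (rule insert.IH) (use True in \<open>auto intro!: insert.prems(2)\<close>)
    moreover have "h integrable_on {x..b}"
      by (rule insert.IH) (use True in \<open>auto intro!: insert.prems(2)\<close>)
    ultimately show ?thesis
      using True by (intro Henstock_Kurzweil_Integration.integrable_combine[of a x b]) auto
  next
    case False
    show ?thesis
      by (rule insert.IH[OF insert.prems(1)]) (use False in \<open>auto intro!: insert.prems(2)\<close>)
  qed
qed

lemma DERIV_of_C1_on:
  assumes "C1_on s t h"
  obtains h' where "continuous_on {s..t} h'"
    "\<And>u. u \<in> {s<..<t} \<Longrightarrow> (h has_real_derivative h' u) (at u)"
proof -
  obtain h' where h': "continuous_on {s..t} h'"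
    "\<And>u. u \<in> {s..t} \<Longrightarrow> (h has_real_derivative h' u) (at u within {s..t})"
    using assms unfolding C1_on_def by blast
  have "(h has_real_derivative h' u) (at u)" if "u \<in> {s<..<t}" for u
    using h'(2)[of u] that by (simp add: at_within_Icc_at)
  with h'(1) that show ?thesis
    by blast
qed

lemma C1_on_affine:
  assumes "\<And>u. u \<in> {s..t} \<Longrightarrow> h u = \<alpha> + \<beta> * u"
  shows "C1_on s t h"
proof -
  have "(h has_real_derivative \<beta>) (at u within {s..t})" if "u \<in> {s..t}" for u
  proof (rule has_field_derivative_transform_within[OF _ zero_less_one that])
    show "((\<lambda>u. \<alpha> + \<beta> * u) has_real_derivative \<beta>) (at u within {s..t})"
      by (auto intro!: derivative_eq_intros)
  qed (simp add: assms)
  then show ?thesis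
    unfolding C1_on_def by (intro exI[of _ "\<lambda>_. \<beta>"]) auto
qed

text \<open>The fundamental theorem of calculus with finitely many exceptional points, followed by
  domination of the derivative. It turns a pointwise bound by the speed into a bound on displacement
  by length.\<close>

lemma abs_diff_le_integral:
  fixes h \<sigma> :: "real \<Rightarrow> real"
  assumes cont: "continuous_on {0..1} h" and "finite F"
    and deriv: "\<And>u. u \<in> {0<..<1} - F \<Longrightarrow> (h has_real_derivative h' u) (at u)"
    and le: "\<And>u. u \<in> {0..1} \<Longrightarrow> \<bar>h' u\<bar> \<le> c * \<sigma> u"
    and int: "\<sigma> integrable_on {0..1}" and nonneg: "\<And>u. \<sigma> u \<ge> 0" and "c \<ge> 0"
    and u: "u \<in> {0..1}"
  shows "\<bar>h u - h 0\<bar> \<le> c * integral {0..1} \<sigma>"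
proof -
  have h': "(h' has_integral (h u - h 0)) {0..u}"
  proof (rule fundamental_theorem_of_calculus_interior_strong[OF \<open>finite F\<close>])
    show "continuous_on {0..u} h"
      by (rule continuous_on_subset[OF cont]) (use u in auto)
  qed (use u deriv in \<open>auto simp: has_real_derivative_iff_has_vector_derivative[symmetric]\<close>)
  have int': "(\<lambda>u. c * \<sigma> u) integrable_on {0..1}"
    using integrable_cmul[OF int, of c] by simp
  then have int_u: "(\<lambda>u. c * \<sigma> u) integrable_on {0..u}"
    by (rule integrable_on_subinterval) (use u in auto)
  have "norm (integral {0..u} h') \<le> integral {0..u} (\<lambda>u. c * \<sigma> u)"
    by (rule integral_norm_bound_integral) (use h' int_u le u in auto)
  also have "\<dots> \<le> integral {0..1} (\<lambda>u. c * \<sigma> u)"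
    by (rule integral_subset_le) (use u int_u int' nonneg \<open>c \<ge> 0\<close> in auto)
  finally show ?thesis
    using h' by (simp add: integral_unique)
qed

lemma speed_hyp_group:
  assumes "n > 0" "\<gamma> t \<in> topspace (Euclidean_space n)"
  shows "speed n {id_chart n} (hyp_group_metric n) \<gamma> t =
    sqrt ((deriv (\<lambda>u. \<gamma> u (n - 1)) t)\<^sup>2 +
      exp (- 2 * \<gamma> t (n - 1)) * (\<Sum>i<n - 1. (deriv (\<lambda>u. \<gamma> u i) t)\<^sup>2))"
proof -
  \<comment> \<open>The atlas has a single chart, so the choice is forced.\<close>
  have "(SOME c. c \<in> {id_chart n} \<and> \<gamma> t \<in> fst c) = id_chart n"
    by (rule some_equality) (use assms in auto)
  then have "speed n {id_chart n} (hyp_group_metric n) \<gamma> t =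
      sqrt (\<Sum>i<n. (if i = n - 1 then 1 else exp (- 2 * \<gamma> t (n - 1))) * (deriv (\<lambda>u. \<gamma> u i) t)\<^sup>2)"
    by (simp only: speed_def Let_def sum_hyp_group_metric id_chart_simps)
  moreover obtain l where "n = Suc l"
    using assms gr0_conv_Suc by blast
  ultimately show ?thesis
    by (simp add: sum_distrib_left)
qed

section \<open>Speed and displacement of a curve in the group\<close>

context
  fixes n :: nat and \<gamma> :: "real \<Rightarrow> nat \<Rightarrow> real"
  assumes n: "n > 0"
    and \<gamma>: "piecewise_C1_curve n (Euclidean_space n) {id_chart n} \<gamma>"
begin

abbreviation (input) \<sigma> where "\<sigma> \<equiv> speed n {id_chart n} (hyp_group_metric n) \<gamma>"

lemma curve_in_Euclidean_space: "t \<in> {0..1} \<Longrightarrow> \<gamma> t \<in> topspace (Euclidean_space n)"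
  using \<gamma> by (auto simp: piecewise_C1_curve_def pathin_def continuous_map_def)

lemma curve_continuous: "continuous_on {0..1} (\<lambda>u. \<gamma> u i)"
proof -
  have "continuous_map (top_of_set {0..1}) (Euclidean_space n) \<gamma>"
    using \<gamma> by (simp add: piecewise_C1_curve_def pathin_def)
  from continuous_map_compose[OF this continuous_map_Euclidean_space_coordinate] show ?thesis
    by (simp add: o_def)
qed

lemma speed_nonneg: "\<sigma> t \<ge> 0"
  unfolding speed_def Let_def sum_hyp_group_metric by (auto intro!: sum_nonneg)

text \<open>The speed is built from the same values of \<open>deriv\<close>, so the inequality is
  purely algebraic and holds even at break points, where the curve may have no derivative.\<close>

lemma abs_deriv_height_le_speed:
  assumes "t \<in> {0..1}"
  shows "\<bar>deriv (\<lambda>u. \<gamma> u (n - 1)) t\<bar> \<le> \<sigma> t"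
  unfolding speed_hyp_group[of n \<gamma>, OF n curve_in_Euclidean_space[OF assms]]
  by (rule real_le_rsqrt) (auto intro!: mult_nonneg_nonneg sum_nonneg)

lemma abs_deriv_le_speed:
  assumes "t \<in> {0..1}" "i < n - 1"
  shows "\<bar>deriv (\<lambda>u. \<gamma> u i) t\<bar> \<le> exp (\<gamma> t (n - 1)) * \<sigma> t"
proof -
  define h where "h = \<gamma> t (n - 1)"
  have "(deriv (\<lambda>u. \<gamma> u i) t)\<^sup>2 \<le> (\<Sum>i<n - 1. (deriv (\<lambda>u. \<gamma> u i) t)\<^sup>2)"
    using assms(2) by (intro member_le_sum) auto
  then have "exp (- 2 * h) * (deriv (\<lambda>u. \<gamma> u i) t)\<^sup>2 \<le>
      (deriv (\<lambda>u. \<gamma> u (n - 1)) t)\<^sup>2 + exp (- 2 * h) * (\<Sum>i<n - 1. (deriv (\<lambda>u. \<gamma> u i) t)\<^sup>2)"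
    by (intro add_increasing mult_left_mono) auto
  moreover have "exp (- 2 * h) * (deriv (\<lambda>u. \<gamma> u i) t)\<^sup>2 = (exp (- h) * \<bar>deriv (\<lambda>u. \<gamma> u i) t\<bar>)\<^sup>2"
    by (simp add: power_mult_distrib flip: exp_double)
  ultimately have "exp (- h) * \<bar>deriv (\<lambda>u. \<gamma> u i) t\<bar> \<le> \<sigma> t"
    unfolding speed_hyp_group[of n \<gamma>, OF n curve_in_Euclidean_space[OF assms(1)]] h_def
    by (intro real_le_rsqrt) simp
  then have "exp h * (exp (- h) * \<bar>deriv (\<lambda>u. \<gamma> u i) t\<bar>) \<le> exp h * \<sigma> t"
    by (intro mult_left_mono) auto
  then show ?thesis
    by (simp add: h_def mult.assoc[symmetric] flip: exp_add)
qed

lemma curve_breaks: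
  obtains F where "finite F"
    "\<And>s t i. 0 \<le> s \<Longrightarrow> s < t \<Longrightarrow> t \<le> 1 \<Longrightarrow> {s<..<t} \<inter> F = {} \<Longrightarrow> i < n \<Longrightarrow> C1_on s t (\<lambda>u. \<gamma> u i)"
proof -
  obtain F where F: "finite F"
    "\<forall>s t. 0 \<le> s \<and> s < t \<and> t \<le> 1 \<and> {s<..<t} \<inter> F = {} \<and> \<gamma> ` {s..t} \<subseteq> topspace (Euclidean_space n) \<longrightarrow>
      (\<forall>i<n. C1_on s t (\<lambda>u. \<gamma> u i))"
    using \<gamma> unfolding piecewise_C1_curve_def by auto
  show ?thesis
  proof (rule that[OF F(1)])
    fix s t :: real and i
    assume st: "0 \<le> s" "s < t" "t \<le> 1" "{s<..<t} \<inter> F = {}" "i < n"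
    then have "\<gamma> ` {s..t} \<subseteq> topspace (Euclidean_space n)"
      using curve_in_Euclidean_space by auto
    with st F(2) show "C1_on s t (\<lambda>u. \<gamma> u i)"
      by blast
  qed
qed

lemma curve_differentiable:
  obtains F where "finite F"
    "\<And>u i. u \<in> {0<..<1} - F \<Longrightarrow> i < n \<Longrightarrow>
       ((\<lambda>u. \<gamma> u i) has_real_derivative deriv (\<lambda>u. \<gamma> u i) u) (at u)"
proof -
  obtain F where F: "finite F" and
    C1: "\<And>s t i. 0 \<le> s \<Longrightarrow> s < t \<Longrightarrow> t \<le> 1 \<Longrightarrow> {s<..<t} \<inter> F = {} \<Longrightarrow> i < n \<Longrightarrow> C1_on s t (\<lambda>u. \<gamma> u i)"
    using curve_breaks by blast
  show ?thesis
  proof (rule that[OF F])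
    fix u :: real and i
    assume u: "u \<in> {0<..<1} - F" and i: "i < n"
    have "open ({0<..<1} - F)"
      using F by (intro open_Diff finite_imp_closed) auto
    \<comment> \<open>Being C1 on a closed interval around \<open>u\<close> yields a two-sided
      derivative at \<open>u\<close>, hence one that agrees with \<open>deriv\<close>.\<close>
    then obtain e where e: "e > 0" "cball u e \<subseteq> {0<..<1} - F"
      using u open_contains_cball by blast
    have "cball u e = {u - e..u + e}"
      by (auto simp: dist_real_def)
    then have e': "{u - e..u + e} \<subseteq> {0<..<1} - F" "u - e \<in> {u - e..u + e}" "u + e \<in> {u - e..u + e}"
      "{u - e<..<u + e} \<subseteq> {u - e..u + e}"
      using e by auto
    then have "u - e \<in> {0<..<1} - F" "u + e \<in> {0<..<1} - F" "{u - e<..<u + e} \<subseteq> {0<..<1} - F"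
      by blast+
    then have "0 \<le> u - e" "u - e < u + e" "u + e \<le> 1" "{u - e<..<u + e} \<inter> F = {}"
      using e by auto
    from DERIV_of_C1_on[OF C1[OF this i]] e(1)
    obtain h' where "((\<lambda>u. \<gamma> u i) has_real_derivative h' u) (at u)"
      by (metis add_less_same_cancel1 diff_less_eq greaterThanLessThan_iff less_add_same_cancel1)
    then show "((\<lambda>u. \<gamma> u i) has_real_derivative deriv (\<lambda>u. \<gamma> u i) u) (at u)"
      by (metis DERIV_imp_deriv)
  qed
qed

lemma speed_integrable: "\<sigma> integrable_on {0..1}"
proof -
  obtain F where F: "finite F" and
    C1: "\<And>s t i. 0 \<le> s \<Longrightarrow> s < t \<Longrightarrow> t \<le> 1 \<Longrightarrow> {s<..<t} \<inter> F = {} \<Longrightarrow> i < n \<Longrightarrow> C1_on s t (\<lambda>u. \<gamma> u i)"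
    using curve_breaks by blast
  show ?thesis
  proof (rule integrable_on_finite_breaks[OF F])
    fix s t :: real
    assume st: "0 \<le> s" "s < t" "t \<le> 1" "{s<..<t} \<inter> F = {}"
    have "\<exists>h'. continuous_on {s..t} h' \<and>
        (\<forall>u\<in>{s<..<t}. ((\<lambda>u. \<gamma> u i) has_real_derivative h' u) (at u))" if "i < n" for i
      by (rule DERIV_of_C1_on[OF C1[OF st that]]) auto
    then obtain h' where cont: "\<And>i. i < n \<Longrightarrow> continuous_on {s..t} (h' i)" and
      h': "\<And>i u. i < n \<Longrightarrow> u \<in> {s<..<t} \<Longrightarrow> ((\<lambda>u. \<gamma> u i) has_real_derivative h' i u) (at u)"
      by metis
    have d: "deriv (\<lambda>u. \<gamma> u i) u = h' i u" if "i < n" "u \<in> {s<..<t}" for i u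
      using h'[OF that] by (rule DERIV_imp_deriv)
    have "continuous_on {s..t} (\<lambda>u. \<gamma> u (n - 1))"
      by (rule continuous_on_subset[OF curve_continuous]) (use st in auto)
    then have "(\<lambda>u. sqrt ((h' (n - 1) u)\<^sup>2 + exp (- 2 * \<gamma> u (n - 1)) * (\<Sum>i<n - 1. (h' i u)\<^sup>2)))
        integrable_on {s..t}"
      by (intro integrable_continuous_real continuous_intros cont) (use n in auto)
    then show "\<sigma> integrable_on {s..t}"
    \<comment> \<open>At \<open>s\<close> and \<open>t\<close> only one-sided derivatives are
      available, so the speed may differ there from the continuous function.\<close>
    proof (rule integrable_spike_finite[of "{s, t}", rotated 2])
      fix u
      assume u: "u \<in> {s..t} - {s, t}"
      then have "\<gamma> u \<in> topspace (Euclidean_space n)"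
        using st by (intro curve_in_Euclidean_space) auto
      from speed_hyp_group[of n \<gamma> u, OF n this] show
        "\<sigma> u = sqrt ((h' (n - 1) u)\<^sup>2 + exp (- 2 * \<gamma> u (n - 1)) * (\<Sum>i<n - 1. (h' i u)\<^sup>2))"
        using u n by (simp add: d)
    qed auto
  qed auto
qed

lemma curve_length_nonneg: "curve_length n {id_chart n} (hyp_group_metric n) \<gamma> \<ge> 0"
  unfolding curve_length_def
  by (rule Henstock_Kurzweil_Integration.integral_nonneg[OF speed_integrable]) (rule speed_nonneg)

lemma displacement_le_curve_length:
  defines "L \<equiv> curve_length n {id_chart n} (hyp_group_metric n) \<gamma>"
  shows "\<bar>\<gamma> 1 (n - 1) - \<gamma> 0 (n - 1)\<bar> \<le> L"
    and "i < n - 1 \<Longrightarrow> \<bar>\<gamma> 1 i - \<gamma> 0 i\<bar> \<le> exp (\<gamma> 0 (n - 1) + L) * L"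
proof -
  obtain F where F: "finite F" and d: "\<And>u i. u \<in> {0<..<1} - F \<Longrightarrow> i < n \<Longrightarrow>
       ((\<lambda>u. \<gamma> u i) has_real_derivative deriv (\<lambda>u. \<gamma> u i) u) (at u)"
    using curve_differentiable by blast
  \<comment> \<open>The height bound is proved for all times, because the horizontal estimate needs
    it along the whole curve.\<close>
  have h: "\<bar>\<gamma> u (n - 1) - \<gamma> 0 (n - 1)\<bar> \<le> L" if "u \<in> {0..1}" for u
  proof -
    have "\<bar>\<gamma> u (n - 1) - \<gamma> 0 (n - 1)\<bar> \<le> 1 * integral {0..1} \<sigma>"
      by (rule abs_diff_le_integral[OF curve_continuous F d])
        (use that n in \<open>auto intro: abs_deriv_height_le_speed[simplified] speed_integrable speed_nonneg\<close>)
    then show ?thesis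
      by (simp add: L_def curve_length_def)
  qed
  then show "\<bar>\<gamma> 1 (n - 1) - \<gamma> 0 (n - 1)\<bar> \<le> L"
    by simp
  assume i: "i < n - 1"
  have "\<bar>\<gamma> 1 i - \<gamma> 0 i\<bar> \<le> exp (\<gamma> 0 (n - 1) + L) * integral {0..1} \<sigma>"
  proof (rule abs_diff_le_integral[OF curve_continuous F d])
    fix u :: real
    assume u: "u \<in> {0..1}"
    have "\<bar>deriv (\<lambda>u. \<gamma> u i) u\<bar> \<le> exp (\<gamma> u (n - 1)) * \<sigma> u"
      by (rule abs_deriv_le_speed[OF u i])
    also have "\<dots> \<le> exp (\<gamma> 0 (n - 1) + L) * \<sigma> u"
      using h[OF u] by (intro mult_right_mono speed_nonneg) auto
    finally show "\<bar>deriv (\<lambda>u. \<gamma> u i) u\<bar> \<le> exp (\<gamma> 0 (n - 1) + L) * \<sigma> u" .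
  qed (use i in \<open>auto intro: speed_integrable speed_nonneg\<close>)
  then show "\<bar>\<gamma> 1 i - \<gamma> 0 i\<bar> \<le> exp (\<gamma> 0 (n - 1) + L) * L"
    by (simp add: L_def curve_length_def)
qed

end

section \<open>An explicit curve between two points\<close>

lemma speed_affine_piece:
  assumes n: "n > 0" and top: "\<gamma> u \<in> topspace (Euclidean_space n)" and u: "u \<in> {s<..<t}"
    and aff: "\<And>u i. u \<in> {s..t} \<Longrightarrow> i < n \<Longrightarrow> \<gamma> u i = \<alpha> i + \<beta> i * u"
  shows "speed n {id_chart n} (hyp_group_metric n) \<gamma> u =
    sqrt ((\<beta> (n - 1))\<^sup>2 + exp (- 2 * \<gamma> u (n - 1)) * (\<Sum>i<n - 1. (\<beta> i)\<^sup>2))"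
proof -
  have "deriv (\<lambda>u. \<gamma> u i) u = \<beta> i" if "i < n" for i
  proof (rule DERIV_imp_deriv)
    show "((\<lambda>u. \<gamma> u i) has_real_derivative \<beta> i) (at u)"
    proof (rule has_field_derivative_transform_within_open[where S = "{s<..<t}"])
      show "((\<lambda>u. \<alpha> i + \<beta> i * u) has_real_derivative \<beta> i) (at u)"
        by (auto intro!: derivative_eq_intros)
    qed (use u aff that in auto)
  qed
  with n show ?thesis
    by (simp add: speed_hyp_group[of n \<gamma> u, OF n top])
qed

text \<open>The vertical pieces contribute \<open>M - p (n - 1)\<close> and
  \<open>M - q (n - 1)\<close>; the horizontal piece, run at logarithmic height \<open>M\<close>,
  has its Euclidean length shrunk by \<open>exp (- M)\<close>.\<close>

lemma up_across_down_curve: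
  assumes n: "n > 0" and p: "p \<in> topspace (Euclidean_space n)" and q: "q \<in> topspace (Euclidean_space n)"
    and M: "p (n - 1) \<le> M" "q (n - 1) \<le> M"
  obtains \<gamma> where "piecewise_C1_curve n (Euclidean_space n) {id_chart n} \<gamma>" "\<gamma> 0 = p" "\<gamma> 1 = q"
    "curve_length n {id_chart n} (hyp_group_metric n) \<gamma> =
       2 * M - p (n - 1) - q (n - 1) + exp (- M) * sqrt (\<Sum>i<n - 1. (q i - p i)\<^sup>2)"
proof -
  define a b where "a = p (n - 1)" and "b = q (n - 1)"
  \<comment> \<open>Clamping to the unit interval: \<open>cl (3 * u)\<close>,
    \<open>cl (3 * u - 1)\<close> and \<open>cl (3 * u - 2)\<close> grow from 0 to 1 on the first,
    second and last third of the time.\<close>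
  define cl where "cl v = max 0 (min 1 v)" for v :: real
  define \<gamma> where "\<gamma> u i = (if i = n - 1 then a + (M - a) * cl (3 * u) + (b - M) * cl (3 * u - 2)
    else p i + (q i - p i) * cl (3 * u - 1))" for u i
  have \<gamma>0: "\<gamma> 0 = p" and \<gamma>1: "\<gamma> 1 = q"
    by (auto simp: \<gamma>_def cl_def fun_eq_iff a_def b_def)
  have top: "\<gamma> u \<in> topspace (Euclidean_space n)" for u
    using p q n by (auto simp: topspace_Euclidean_space \<gamma>_def)
  have cl1: "\<gamma> u i = (if i = n - 1 then a else p i) + (if i = n - 1 then 3 * (M - a) else 0) * u"
    if "u \<in> {0..1/3}" for u i
  proof -
    have cl: "cl (3 * u) = 3 * u" "cl (3 * u - 1) = 0" "cl (3 * u - 2) = 0"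
      using that by (auto simp: cl_def)
    show ?thesis
      unfolding \<gamma>_def cl by (simp add: algebra_simps)
  qed
  have cl2: "\<gamma> u i = (if i = n - 1 then M else p i - (q i - p i)) + (if i = n - 1 then 0 else 3 * (q i - p i)) * u"
    if "u \<in> {1/3..2/3}" for u i
  proof -
    have cl: "cl (3 * u) = 1" "cl (3 * u - 1) = 3 * u - 1" "cl (3 * u - 2) = 0"
      using that by (auto simp: cl_def)
    show ?thesis
      unfolding \<gamma>_def cl by (simp add: algebra_simps)
  qed
  have cl3: "\<gamma> u i = (if i = n - 1 then M - 2 * (b - M) else q i) + (if i = n - 1 then 3 * (b - M) else 0) * u"
    if "u \<in> {2/3..1}" for u i
  proof -
    have cl: "cl (3 * u) = 1" "cl (3 * u - 1) = 1" "cl (3 * u - 2) = 3 * u - 2"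
      using that by (auto simp: cl_def)
    show ?thesis
      unfolding \<gamma>_def cl by (simp add: algebra_simps)
  qed
  have "continuous_map (top_of_set {0..1}) (Euclidean_space n) (\<lambda>u i. if i < n then \<gamma> u i else 0)"
    unfolding continuous_map_componentwise_Euclidean_space \<gamma>_def cl_def
    by (auto intro!: continuous_intros)
  moreover have "(\<lambda>u i. if i < n then \<gamma> u i else 0) = \<gamma>"
    using top by (auto simp: fun_eq_iff topspace_Euclidean_space)
  ultimately have path: "pathin (Euclidean_space n) \<gamma>"
    by (simp add: pathin_def)
  have C1: "C1_on s t (\<lambda>u. \<gamma> u i)" if "0 \<le> s" "s < t" "t \<le> 1" "{s<..<t} \<inter> {1/3, 2/3} = {}" for s t i
  proof -
    have "1/3 \<notin> {s<..<t}" "2/3 \<notin> {s<..<t}"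
      using that by blast+
    then consider "t \<le> 1/3" | "1/3 \<le> s" "t \<le> 2/3" | "2/3 \<le> s"
      by force
    then show ?thesis
    proof cases
      case 1
      show ?thesis
        by (rule C1_on_affine, rule cl1) (use 1 that in auto)
    next
      case 2
      show ?thesis
        by (rule C1_on_affine, rule cl2) (use 2 that in auto)
    next
      case 3
      show ?thesis
        by (rule C1_on_affine, rule cl3) (use 3 that in auto)
    qed
  qed
  have curve: "piecewise_C1_curve n (Euclidean_space n) {id_chart n} \<gamma>"
    unfolding piecewise_C1_curve_def
    by (intro conjI path exI[of _ "{1/3, 2/3}"]) (auto intro!: C1)
  let ?\<sigma> = "speed n {id_chart n} (hyp_group_metric n) \<gamma>"
  define X where "X = sqrt (\<Sum>i<n - 1. (q i - p i)\<^sup>2)"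
  \<comment> \<open>Each piece lasts one third of the time, so its speed is three times its
    length.\<close>
  have const: "(?\<sigma> has_integral c) {s..t}"
    if "\<And>u. u \<in> {s<..<t} \<Longrightarrow> ?\<sigma> u = 3 * c" "t = s + 1/3" for s t c
  proof (rule has_integral_spike_finite[of "{s, t}"])
    show "((\<lambda>_. 3 * c) has_integral c) {s..t}"
      using has_integral_const_real[of "3 * c" s t] that(2) by simp
  qed (use that(1) in auto)
  have i1: "(?\<sigma> has_integral (M - a)) {0..1/3}"
  proof (rule const)
    fix u :: real
    assume u: "u \<in> {0<..<1/3}"
    have "?\<sigma> u = \<bar>3 * (M - a)\<bar>"
      using speed_affine_piece[OF n top u cl1] by simp
    then show "?\<sigma> u = 3 * (M - a)"
      using M by (simp add: a_def)
  qed simp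
  have i2: "(?\<sigma> has_integral exp (- M) * X) {1/3..2/3}"
  proof (rule const)
    fix u :: real
    assume u: "u \<in> {1/3<..<2/3}"
    have "(\<Sum>i<n - 1. (if i = n - 1 then 0 else 3 * (q i - p i))\<^sup>2) = 9 * (\<Sum>i<n - 1. (q i - p i)\<^sup>2)"
      unfolding sum_distrib_left
      by (intro sum.cong refl) (auto simp: power2_eq_square algebra_simps)
    moreover have "\<gamma> u (n - 1) = M"
      using cl2[of u "n - 1"] u by simp
    ultimately have "?\<sigma> u = sqrt (exp (- 2 * M) * (9 * (\<Sum>i<n - 1. (q i - p i)\<^sup>2)))"
      using speed_affine_piece[OF n top u cl2] by simp
    also have "exp (- 2 * M) * (9 * (\<Sum>i<n - 1. (q i - p i)\<^sup>2)) = (3 * exp (- M))\<^sup>2 * (\<Sum>i<n - 1. (q i - p i)\<^sup>2)"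
      by (simp add: power_mult_distrib flip: exp_double)
    finally show "?\<sigma> u = 3 * (exp (- M) * X)"
      by (simp add: real_sqrt_mult X_def)
  qed simp
  have i3: "(?\<sigma> has_integral (M - b)) {2/3..1}"
  proof (rule const)
    fix u :: real
    assume u: "u \<in> {2/3<..<1}"
    have "?\<sigma> u = \<bar>3 * (b - M)\<bar>"
      using speed_affine_piece[OF n top u cl3] by simp
    then show "?\<sigma> u = 3 * (M - b)"
      using M by (simp add: b_def)
  qed simp
  have "(?\<sigma> has_integral (M - a) + exp (- M) * X) {0..2/3}"
    by (rule has_integral_combine[OF _ _ i1 i2]) simp_all
  from has_integral_combine[OF _ _ this i3]
  have "(?\<sigma> has_integral (M - a) + exp (- M) * X + (M - b)) {0..1}"
    by simp
  then have "curve_length n {id_chart n} (hyp_group_metric n) \<gamma> =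
      2 * M - p (n - 1) - q (n - 1) + exp (- M) * sqrt (\<Sum>i<n - 1. (q i - p i)\<^sup>2)"
    unfolding curve_length_def by (simp add: integral_unique a_def b_def X_def)
  with curve \<gamma>0 \<gamma>1 that show ?thesis
    by blast
qed

section \<open>Comparison of the distances\<close>

text \<open>The passage from the logarithmic height of the group to the height of the upper
  half-space model.\<close>

definition exp_height :: "nat \<Rightarrow> (nat \<Rightarrow> real) \<Rightarrow> nat \<Rightarrow> real" where
  "exp_height n x = x(n - 1 := exp (x (n - 1)))"

lemma exp_height_image:
  assumes "n > 0"
  shows "exp_height n ` topspace (Euclidean_space n) = hyp_space n"
proof
  show "exp_height n ` topspace (Euclidean_space n) \<subseteq> hyp_space n"
    using assms by (auto simp: exp_height_def hyp_space_def topspace_Euclidean_space)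
  show "hyp_space n \<subseteq> exp_height n ` topspace (Euclidean_space n)"
  proof
    fix y
    assume "y \<in> hyp_space n"
    then have "y = exp_height n (y(n - 1 := ln (y (n - 1))))"
      "y(n - 1 := ln (y (n - 1))) \<in> topspace (Euclidean_space n)"
      using assms by (auto simp: exp_height_def hyp_space_def topspace_Euclidean_space)
    then show "y \<in> exp_height n ` topspace (Euclidean_space n)"
      by blast
  qed
qed

lemma exp_height_in_hyp_space:
  "n > 0 \<Longrightarrow> x \<in> topspace (Euclidean_space n) \<Longrightarrow> exp_height n x \<in> hyp_space n"
  using exp_height_image by blast

section \<open>Hyperbolic distance against curve length\<close>

context
  fixes n :: nat and p q :: "nat \<Rightarrow> real"
  assumes n: "n > 0" and p: "p \<in> topspace (Euclidean_space n)" and q: "q \<in> topspace (Euclidean_space n)"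
begin

lemma cosh_hyp_dist_exp_height:
  "2 * cosh (hyp_dist n (exp_height n p) (exp_height n q)) =
     exp (p (n - 1) - q (n - 1)) + exp (q (n - 1) - p (n - 1)) +
     (\<Sum>i<n - 1. (q i - p i)\<^sup>2) / exp (p (n - 1) + q (n - 1))"
proof -
  obtain l where l: "n = Suc l"
    using n gr0_conv_Suc by blast
  have "(\<Sum>i<n. (exp_height n p i - exp_height n q i)\<^sup>2) =
      (\<Sum>i<n - 1. (q i - p i)\<^sup>2) + (exp (p (n - 1)) - exp (q (n - 1)))\<^sup>2"
    unfolding l by (simp add: exp_height_def power2_commute)
  moreover have "2 * (1 + (s + (a - b)\<^sup>2) / (2 * a * b)) = a / b + b / a + s / (a * b)"
    if "a > 0" "b > 0" for a b s :: real
    using that by (simp add: field_simps power2_eq_square)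
  ultimately show ?thesis
    unfolding cosh_hyp_dist[OF exp_height_in_hyp_space[OF n p] exp_height_in_hyp_space[OF n q]]
    by (simp add: exp_height_def exp_diff exp_add)
qed

lemma hyp_dist_le_curve_length:
  assumes \<gamma>: "piecewise_C1_curve n (Euclidean_space n) {id_chart n} \<gamma>" and "\<gamma> 0 = p" "\<gamma> 1 = q"
  shows "hyp_dist n (exp_height n p) (exp_height n q) \<le>
    5 * curve_length n {id_chart n} (hyp_group_metric n) \<gamma> + ln (2 * (n + 1))"
proof -
  define L where "L = curve_length n {id_chart n} (hyp_group_metric n) \<gamma>"
  define a b where "a = p (n - 1)" and "b = q (n - 1)"
  note disp = displacement_le_curve_length[OF n \<gamma>, folded L_def, unfolded assms(2,3)]
  have ab: "\<bar>b - a\<bar> \<le> L"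
    using disp(1) by (simp add: a_def b_def)
  \<comment> \<open>The displacement is at most \<open>exp (a + L) * L\<close>, hence at most
    \<open>exp (a + 2 * L)\<close>. Squaring gives \<open>4 * L\<close> in the exponent, and
    \<open>a - b\<close> adds at most another \<open>L\<close>.\<close>
  have "(q i - p i)\<^sup>2 / exp (a + b) \<le> exp (5 * L)" if "i < n - 1" for i
  proof -
    have "exp (a + L) * L \<le> exp (a + L) * exp L"
      using exp_ge_add_one_self[of L] by (intro mult_left_mono exp_ge_zero) linarith
    with disp(2)[OF that] have "\<bar>q i - p i\<bar> \<le> exp (a + 2 * L)"
      by (simp add: a_def mult_exp_exp algebra_simps)
    then have "\<bar>q i - p i\<bar>\<^sup>2 \<le> (exp (a + 2 * L))\<^sup>2"
      by (intro power_mono) auto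
    then have "(q i - p i)\<^sup>2 / exp (a + b) \<le> exp (2 * (a + 2 * L)) / exp (a + b)"
      unfolding exp_double by (intro divide_right_mono) auto
    also have "\<dots> = exp (a - b + 4 * L)"
      by (simp flip: exp_diff)
    also have "\<dots> \<le> exp (5 * L)"
      using ab by simp
    finally show ?thesis .
  qed
  then have "(\<Sum>i<n - 1. (q i - p i)\<^sup>2) / exp (a + b) \<le> (\<Sum>i<n - 1. exp (5 * L))"
    unfolding sum_divide_distrib by (intro sum_mono) auto
  moreover have "exp (a - b) \<le> exp (5 * L)" "exp (b - a) \<le> exp (5 * L)"
    using ab by auto
  moreover have "(\<Sum>i<n - 1. exp (5 * L)) = real n * exp (5 * L) - exp (5 * L)"
    using n by (simp add: of_nat_diff algebra_simps)
  moreover have "real (n + 1) * exp (5 * L) = real n * exp (5 * L) + exp (5 * L)"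
    by (simp add: algebra_simps)
  \<comment> \<open>There are \<open>n - 1\<close> horizontal terms and two vertical ones, each at
    most \<open>exp (5 * L)\<close>.\<close>
  ultimately have "2 * cosh (hyp_dist n (exp_height n p) (exp_height n q)) \<le> (n + 1) * exp (5 * L)"
    unfolding cosh_hyp_dist_exp_height a_def[symmetric] b_def[symmetric] by linarith
  then have "cosh (hyp_dist n (exp_height n p) (exp_height n q)) \<le> (n + 1) * exp (5 * L)"
    by (smt (verit) cosh_real_nonneg)
  from le_cosh_exp_bound[OF this] show ?thesis
    by (simp add: L_def)
qed

lemma exists_curve_length_le_hyp_dist:
  obtains \<gamma> where "piecewise_C1_curve n (Euclidean_space n) {id_chart n} \<gamma>" "\<gamma> 0 = p" "\<gamma> 1 = q"
    "curve_length n {id_chart n} (hyp_group_metric n) \<gamma> \<le>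
       hyp_dist n (exp_height n p) (exp_height n q) + ln 2 + 1"
proof -
  define D where "D = hyp_dist n (exp_height n p) (exp_height n q)"
  define a b where "a = p (n - 1)" and "b = q (n - 1)"
  define X where "X = sqrt (\<Sum>i<n - 1. (q i - p i)\<^sup>2)"
  \<comment> \<open>The height at which to cross: not below either end point, and high enough for
    the horizontal piece to have length at most 1.\<close>
  define E where "E = max (max (exp a) (exp b)) X"
  have X: "X \<ge> 0" "X\<^sup>2 = (\<Sum>i<n - 1. (q i - p i)\<^sup>2)"
    by (auto simp: X_def sum_nonneg)
  have E: "exp a \<le> E" "exp b \<le> E" "X \<le> E" "E > 0"
    by (auto simp: E_def less_max_iff_disj)
  define M where "M = ln E"
  have M: "exp M = E" "p (n - 1) \<le> M" "q (n - 1) \<le> M"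
    using E by (auto simp: M_def ln_ge_iff a_def b_def)
  \<comment> \<open>The maximum of three squares is at most their sum, which is
    \<open>2 * cosh D * exp (a + b)\<close>; taking logarithms bounds the vertical part
    \<open>2 * M - a - b\<close> by \<open>D + ln 2\<close>.\<close>
  have "E\<^sup>2 \<le> (exp a)\<^sup>2 + (exp b)\<^sup>2 + X\<^sup>2"
    by (auto simp: E_def max_def)
  also have "\<dots> = 2 * cosh D * exp (a + b)"
    unfolding D_def cosh_hyp_dist_exp_height a_def[symmetric] b_def[symmetric] X(2)
    by (simp add: algebra_simps exp_add exp_diff power2_eq_square)
  also have "\<dots> \<le> 2 * exp D * exp (a + b)"
    using cosh_le_exp_real[of D] hyp_dist_nonneg[OF exp_height_in_hyp_space[OF n p] exp_height_in_hyp_space[OF n q]]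
    by (simp add: D_def)
  also have "\<dots> = exp (ln 2 + D + a + b)"
    by (simp add: exp_add)
  also have "E\<^sup>2 = exp (2 * M)"
    by (simp add: exp_double M)
  finally have "2 * M \<le> ln 2 + D + a + b"
    by simp
  moreover have "exp (- M) * X \<le> 1"
    using E by (simp add: exp_minus M field_simps)
  ultimately show ?thesis
    using up_across_down_curve[OF n p q M(2,3)] that
    unfolding a_def b_def X_def D_def by (smt (verit))
qed

lemma riemannian_dist_hyp_group_bounds:
  defines "d \<equiv> riemannian_dist n (Euclidean_space n) {id_chart n} (hyp_group_metric n) p q"
  shows "d \<ge> 0" and "d \<le> hyp_dist n (exp_height n p) (exp_height n q) + (ln 2 + 1)"
    and "hyp_dist n (exp_height n p) (exp_height n q) \<le> 5 * d + ln (2 * (n + 1))"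
proof -
  define \<L> where "\<L> = {curve_length n {id_chart n} (hyp_group_metric n) \<gamma> | \<gamma>.
    piecewise_C1_curve n (Euclidean_space n) {id_chart n} \<gamma> \<and> \<gamma> 0 = p \<and> \<gamma> 1 = q}"
  have d: "d = Inf \<L>"
    by (simp add: d_def riemannian_dist_def \<L>_def)
  obtain l where l: "l \<in> \<L>" "l \<le> hyp_dist n (exp_height n p) (exp_height n q) + ln 2 + 1"
    using exists_curve_length_le_hyp_dist unfolding \<L>_def by blast
  have nonneg: "x \<ge> 0" if "x \<in> \<L>" for x
    using that curve_length_nonneg[OF n] by (auto simp: \<L>_def)
  show "d \<ge> 0"
    unfolding d using l(1) nonneg by (intro cInf_greatest) auto
  have "d \<le> l"
    unfolding d using l(1) nonneg by (intro cInf_lower bdd_belowI) auto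
  with l(2) show "d \<le> hyp_dist n (exp_height n p) (exp_height n q) + (ln 2 + 1)"
    by simp
  \<comment> \<open>The bound holds for every connecting curve, so it passes to the infimum once it
    is solved for the length.\<close>
  have "(hyp_dist n (exp_height n p) (exp_height n q) - ln (2 * (n + 1))) / 5 \<le> d"
    unfolding d
  proof (rule cInf_greatest)
    show "\<L> \<noteq> {}"
      using l(1) by blast
    show "(hyp_dist n (exp_height n p) (exp_height n q) - ln (2 * (n + 1))) / 5 \<le> x" if "x \<in> \<L>" for x
      using that hyp_dist_le_curve_length by (force simp: \<L>_def)
  qed
  then show "hyp_dist n (exp_height n p) (exp_height n q) \<le> 5 * d + ln (2 * (n + 1))"
    by simp
qed

end

section \<open>From the group to the product of hyperbolic spaces\<close>

lemma exp_height_quasi_isometric_embedding: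
  assumes "n > 0"
  shows "quasi_isometric_embedding (carrier (hyp_group n))
    (riemannian_dist n (Euclidean_space n) {id_chart n} (hyp_group_metric n))
    (hyp_space n) (hyp_dist n) (exp_height n)"
proof -
  define e where "e = ln 2 + 1 + ln (2 * (real n + 1))"
  have e: "ln 2 + 1 \<le> e" "ln (2 * (real n + 1)) \<le> e" "e \<ge> 0"
    by (auto simp: e_def intro!: add_nonneg_nonneg)
  have "1 / 5 * riemannian_dist n (Euclidean_space n) {id_chart n} (hyp_group_metric n) p q - e
          \<le> hyp_dist n (exp_height n p) (exp_height n q) \<and>
        hyp_dist n (exp_height n p) (exp_height n q)
          \<le> 5 * riemannian_dist n (Euclidean_space n) {id_chart n} (hyp_group_metric n) p q + e"
    if "p \<in> carrier (hyp_group n)" "q \<in> carrier (hyp_group n)" for p q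
    \<comment> \<open>The lower bound holds with factor 1; it weakens to \<open>1 / 5\<close>
      because the Riemannian distance is nonnegative.\<close>
    using riemannian_dist_hyp_group_bounds[of n p q] assms that e by (simp add: algebra_simps)
  moreover have "exp_height n \<in> carrier (hyp_group n) \<rightarrow> hyp_space n"
    using exp_height_in_hyp_space[OF assms] by simp
  ultimately show ?thesis
    unfolding quasi_isometric_embedding_def using e(3)
    by (intro conjI exI[of _ 5] exI[of _ e]) auto
qed

theorem proposition4p1:
  fixes k N :: nat and m :: "nat \<Rightarrow> nat"
  assumes "k \<ge> 2"
    and "\<And>i. i < k \<Longrightarrow> m i > 1"
    and "N = (\<Sum>i<k. m i) - k + 1"
  shows "(\<exists>f. quasi_isometric_embedding (hyp_space N) (hyp_dist N) (hyp_prod k m) (hyp_prod_dist k m) f \<and>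
              \<not> quasiconvex (hyp_prod k m) (hyp_prod_dist k m) (f ` hyp_space N)) \<and>
         (\<exists>(G :: (nat \<Rightarrow> real) monoid) T A g f.
              lie_group N G T A \<and> connected_space T \<and> solvable G \<and>
              riemannian_metric N A g \<and> left_invariant N G A g \<and>
              quasi_isometric_embedding (carrier G) (riemannian_dist N T A g)
                (hyp_prod k m) (hyp_prod_dist k m) f \<and>
              \<not> quasiconvex (hyp_prod k m) (hyp_prod_dist k m) (f ` carrier G))"
proof (intro conjI exI)
  \<comment> \<open>As every \<open>m i\<close> exceeds 1, no subtraction of naturals is truncated,
    and \<open>N - 1\<close> is the total number of horizontal coordinates of the factors.\<close>
  have "(\<Sum>i<k. m i - 1) + k = (\<Sum>i<k. m i)"
  proof -
    have "(\<Sum>i<k. m i - 1) + k = (\<Sum>i<k. (m i - 1) + 1)"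
      unfolding sum.distrib by simp
    also have "\<dots> = (\<Sum>i<k. m i)"
      using assms(2) by (intro sum.cong refl) fastforce
    finally show ?thesis .
  qed
  with assms(3) have N: "N = Suc (\<Sum>i<k. m i - 1)"
    by simp
  then have "N > 0" and k: "k > 0" "k > 1"
    using assms(1) by auto
  note qi = equal_height_map_quasi_isometric_embedding[OF k(1) assms(2) N]
  note not_qc = equal_height_map_not_quasiconvex[OF k(1) assms(2) N k(2)]
  show "quasi_isometric_embedding (hyp_space N) (hyp_dist N) (hyp_prod k m) (hyp_prod_dist k m) (equal_height_map k m)"
    by (rule qi)
  show "\<not> quasiconvex (hyp_prod k m) (hyp_prod_dist k m) (equal_height_map k m ` hyp_space N)"
    by (rule not_qc)
  show "lie_group N (hyp_group N) (Euclidean_space N) {id_chart N}"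
    by (rule lie_group_hyp_group[OF \<open>N > 0\<close>])
  show "connected_space (Euclidean_space N)"
    by (rule connected_Euclidean_space)
  show "solvable (hyp_group N)"
    by (rule solvable_hyp_group)
  show "riemannian_metric N {id_chart N} (hyp_group_metric N)"
    by (rule riemannian_metric_hyp_group)
  show "left_invariant N (hyp_group N) {id_chart N} (hyp_group_metric N)"
    by (rule left_invariant_hyp_group[OF \<open>N > 0\<close>])
  show "quasi_isometric_embedding (carrier (hyp_group N))
      (riemannian_dist N (Euclidean_space N) {id_chart N} (hyp_group_metric N))
      (hyp_prod k m) (hyp_prod_dist k m) (equal_height_map k m \<circ> exp_height N)"
    by (rule quasi_isometric_embedding_compose[OF exp_height_quasi_isometric_embedding[OF \<open>N > 0\<close>] qi])
  show "\<not> quasiconvex (hyp_prod k m) (hyp_prod_dist k m)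
      ((equal_height_map k m \<circ> exp_height N) ` carrier (hyp_group N))"
    \<comment> \<open>Since \<open>exp_height N\<close> maps the group onto
      \<open>hyp_space N\<close>, both embeddings have the same image.\<close>
    using not_qc exp_height_image[OF \<open>N > 0\<close>] by (simp only: image_comp[symmetric] hyp_group_simps not_False_eq_True)
qed

end
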